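(* Let $i\in\{0,1\}$. For $P\in\{(1,0),(-1,0)\}$, $$\lim_{T\to\infty}\liminf_{X\to\infty}\frac{C_{P,T}^{(i)}(X)}{C_P^{(i)}(X)}=1 .$$ For every other fixed primitive vector $P\in\mathbb Z^2$, $$\lim_{T\to\infty}\limsup_{X\to\infty}\frac{C_{P,T}^{(i)}(X)}{C_P^{(i)}(X)}=0 .$$
   Context: Forms and action: $V_{\mathbb R}$ is the space of real binary cubic forms $f(X,Y)=aX^3+bX^2Y+cXY^2+dY^3$, with $\mathrm{GL}_2(\mathbb R)$ acting by the twisted action $(g\cdot f)(X,Y)=\det(g)^{-1}f((X,Y)g)$, where $(X,Y)$ is a row vector. $\mathrm{Disc}(f)=b^2c^2-4ac^3-4b^3d-27a^2d^2+18abcd$. $V_{\mathbb R}^{(0)}$ (resp. $V_{\mathbb R}^{(1)}$) is the set of forms with $\mathrm{Disc}(f)>0$ (resp. $<0$); $V_{\mathbb Z}^{(i)}$ is the set of forms in $V_{\mathbb R}^{(i)}$ with integer coefficients $a,b,c,d$; $V_{\mathbb Z}^{(i),\mathrm{irr}}$ is the subset of forms irreducible over $\mathbb Q$. Fundamental domain: put $n(u)=\begin{pmatrix}1&0\\ u&1\end{pmatrix}$, $a(t)=\begin{pmatrix}t^{-1}&0\\0&t\end{pmatrix}$, $K=\mathrm{SO}_2(\mathbb R)$, $t_0=\sqrt[4]{3}/\sqrt2$; a scalar $\lambda>0$ stands for $\lambda I_2$. Gauss's usual fundamental domain for $\mathrm{GL}_2(\mathbb Z)\backslash\mathrm{GL}_2(\mathbb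 R)$ is $\mathcal F=\{n(u)a(t)k\lambda: u\in\nu(t),\ t\ge t_0,\ k\in K,\ \lambda>0\}$, where $\nu(t)\subset[-\frac12,\frac12]$ is a union of at most two intervals with $\nu(t)=[-\frac12,\frac12]$ for $t\ge1$ (explicitly, up to boundary, $\nu(t)=\{u\in[-\frac12,\frac12]:u^2+t^4\ge1\}$). For $T>t_0$, $\mathcal F_T=\{n(u)a(t)k\lambda\in\mathcal F:t>T\}$. Shape parameter: a real form $f=ax^3+bx^2y+cxy^2+dy^3$ of nonzero discriminant corresponds (Delone–Faddeev) to the cubic $\mathbb R$-algebra with basis $1,\omega,\theta$ and $\omega\theta=-ad$, $\omega^2=-ac+b\omega-a\theta$, $\theta^2=-bd+d\omega-c\theta$. If $\mathrm{Disc}(f)<0$ this algebra is $\mathbb R\oplus\mathbb C$; let $z_\omega,z_\theta$ be the images of $\omega,\theta$ in $(\mathbb R\oplus\mathbb C)/\mathbb R(1,1)\simeq\mathbb C$, with the complex embedding chosen so that $\Im(z_\theta/z_\omega)>0$, and $\tau_f=z_\theta/z_\omega$. If $\mathrm{Disc}(f)>0$, let $x^0=x-\mathrm{Tr}(x)/3$, $A_0=\mathrm{Tr}((\omega^0)^2)$, $B_0=\mathrm{Tr}(\omega^0\theta^0)$, $C_0=\mathrm{Tr}((\theta^0)^2)$, and $\tau_f=(B_0+\sqrt{-1}\sqrt{A_0C_0-B_0^2})/A_0$. For each $i\in\{0,1\}$ a base form $v^{(i)}\in V_{\mathbb R}^{(i)}$ with $\tau_{v^{(i)}}=\sqrt{-1}$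 is fixed. Normalized models: a normalized integral Weierstrass model is an equation $y^2=x^3+ux^2+Ax+B$ with $u\in\{0,1,2\}$, $A,B\in\mathbb Z$; models are counted as equations, not up to isomorphism. Let $f$ be an irreducible integral binary cubic form and $P\in\mathbb Z^2$ with $f(P)=1$ (then $P$ is primitive). Choose $M_P\in\mathrm{SL}_2(\mathbb Z)$ with first row $P$; then $M_P\cdot f$ is monic, $M_P\cdot f=X^3+bX^2Y+cXY^2+dY^3$. Let $u\in\{0,1,2\}$ with $u\equiv b\pmod 3$, $k=(u-b)/3$, $T_k=\begin{pmatrix}1&0\\ k&1\end{pmatrix}$, and $F_{f,P}=T_kM_P\cdot f=X^3+uX^2Y+AXY^2+BY^3$. Then $E_{f,P}$ is the model $y^2=x^3+ux^2+Ax+B$ (independent of the choice of $M_P$). Counts: fix constants $0<c_-<c_+$. For primitive $P$, let $\mathscr S_P^{(i)}(X)$ be the multiset of forms $f\in\mathcal Fv^{(i)}\cap V_{\mathbb Z}^{(i),\mathrm{irr}}$ with $f(P)=1$ and $c_-X\le|\mathrm{Disc}(f)|<c_+X$, and $\mathscr S_{P,T}^{(i)}(X)$ the submultiset obtained by requiring $f\in\mathcal F_Tv^{(i)}$. Set $C_P^{(i)}(X)=\#\{E_{f,P}:f\in\mathscr S_P^{(i)}(X)\}$ and $C_{P,T}^{(i)}(X)=\#\{E_{f,P}:f\in\mathscr S_{P,T}^{(i)}(X)\}$, both being cardinalities of sets of distinct models. *)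

theory Defs
  imports "HOL-Analysis.Analysis" "HOL-Computational_Algebra.Polynomial"
begin

section \<open>Binary cubic forms\<close>

text \<open>\<open>Cubic a b c d\<close> stands for $aX^3+bX^2Y+cXY^2+dY^3$.\<close>

datatype 'a cubic_form = Cubic (ca: 'a) (cb: 'a) (cc: 'a) (cd: 'a)

definition eval_form :: "'a::comm_semiring_1 cubic_form \<Rightarrow> 'a^2 \<Rightarrow> 'a" where
  "eval_form f w = ca f * (w$1)^3 + cb f * (w$1)^2 * w$2 + cc f * w$1 * (w$2)^2 + cd f * (w$2)^3"

definition disc :: "'a::comm_ring_1 cubic_form \<Rightarrow> 'a" where
  "disc f = (cb f)^2 * (cc f)^2 - 4 * ca f * (cc f)^3 - 4 * (cb f)^3 * cd f
            - 27 * (ca f)^2 * (cd f)^2 + 18 * ca f * cb f * cc f * cd f"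

text \<open>\<open>subst_form g f\<close> is the form $f((X,Y)g)$ with $(X,Y)$ a row vector; the coefficients are
  obtained by expanding, see \<open>eval_subst_form\<close>.\<close>

definition subst_form :: "'a::comm_ring_1^2^2 \<Rightarrow> 'a cubic_form \<Rightarrow> 'a cubic_form" where
  "subst_form g f =
    (let p = g$1$1; q = g$1$2; r = g$2$1; s = g$2$2; a = ca f; b = cb f; c = cc f; d = cd f in
     Cubic (a * p^3 + b * p^2 * q + c * p * q^2 + d * q^3)
           (3 * a * p^2 * r + b * (p^2 * s + 2 * p * q * r) + c * (2 * p * q * s + q^2 * r)
              + 3 * d * q^2 * s)
           (3 * a * p * r^2 + b * (2 * p * r * s + q * r^2) + c * (p * s^2 + 2 * q * r * s)
              + 3 * d * q * s^2)
           (a * r^3 + b * r^2 * s + c * r * s^2 + d * s^3))"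

lemma eval_subst_form:
  "eval_form (subst_form g f) w = eval_form f (w v* g)" for f :: "'a::idom cubic_form"
proof -
  have *: "(a * p^3 + b * p^2 * q + c * p * q^2 + d * q^3) * x^3
    + (3 * a * p^2 * r + b * (p^2 * s + 2 * p * q * r) + c * (2 * p * q * s + q^2 * r)
              + 3 * d * q^2 * s) * x^2 * y
    + (3 * a * p * r^2 + b * (2 * p * r * s + q * r^2) + c * (p * s^2 + 2 * q * r * s)
              + 3 * d * q * s^2) * x * y^2
    + (a * r^3 + b * r^2 * s + c * r * s^2 + d * s^3) * y^3
    = a * (p * x + r * y)^3 + b * (p * x + r * y)^2 * (q * x + s * y)
      + c * (p * x + r * y) * (q * x + s * y)^2 + d * (q * x + s * y)^3"
    for a b c d p q r s x y :: 'a
    by algebra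
  show ?thesis
    unfolding eval_form_def subst_form_def vector_matrix_mult_def Let_def sum_2
    by (simp add: * mult.commute[of "w $ _"])
qed

definition twisted_act :: "'a::field^2^2 \<Rightarrow> 'a cubic_form \<Rightarrow> 'a cubic_form" where
  "twisted_act g f = map_cubic_form (\<lambda>x. inverse (det g) * x) (subst_form g f)"

lemma eval_twisted_act: "eval_form (twisted_act g f) w = inverse (det g) * eval_form f (w v* g)"
  unfolding eval_subst_form[symmetric]
  by (simp add: twisted_act_def eval_form_def cubic_form.map_sel algebra_simps)

abbreviation real_form :: "int cubic_form \<Rightarrow> real cubic_form" where
  "real_form \<equiv> map_cubic_form of_int"

text \<open>On integral forms, matrices of determinant 1 act by plain substitution.\<close>

lemma twisted_act_of_int:
  assumes "det (M :: int^2^2) = 1"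
  shows "twisted_act (\<chi> i j. of_int (M$i$j)) (real_form f) = real_form (subst_form M f)"
proof -
  have "det ((\<chi> i j. of_int (M$i$j)) :: real^2^2) = of_int (det M)"
    by (simp add: det_2)
  then show ?thesis
    using assms by (simp add: twisted_act_def subst_form_def Let_def cubic_form.map_sel)
qed

text \<open>The form as an element of $R[X][Y]$: the outer polynomial variable is $Y$, the inner one
  is $X$. Irreducibility over the rationals is irreducibility in the ring
  $\mathbf Q[X][Y]=\mathbf Q[X,Y]$.\<close>

definition form_poly :: "'a::comm_ring_1 cubic_form \<Rightarrow> 'a poly poly" where
  "form_poly f = [: monom (ca f) 3, monom (cb f) 2, monom (cc f) 1, monom (cd f) 0 :]"

definition irreducible_over_rat :: "int cubic_form \<Rightarrow> bool" where
  "irreducible_over_rat f \<longleftrightarrow> irreducible (form_poly (map_cubic_form rat_of_int f))"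

text \<open>The index is meant to be 0 or 1.\<close>

definition V_real :: "nat \<Rightarrow> real cubic_form set" where
  "V_real i = (if i = 0 then {f. disc f > 0} else {f. disc f < 0})"

definition V_int_irr :: "nat \<Rightarrow> int cubic_form set" where
  "V_int_irr i = {f. real_form f \<in> V_real i \<and> irreducible_over_rat f}"


section \<open>The shape parameter\<close>

text \<open>The cubic algebra attached to \<open>f\<close> is \<open>real^3\<close> with \<open>x\<close> standing for
  $x_1+x_2\omega+x_3\theta$, and multiplication the bilinear extension of
  $\omega\theta=-ad$, $\omega^2=-ac+b\omega-a\theta$, $\theta^2=-bd+d\omega-c\theta$.\<close>

definition alg_one :: "real^3" where "alg_one = vector [1, 0, 0]"
definition alg_omega :: "real^3" where "alg_omega = vector [0, 1, 0]"
definition alg_theta :: "real^3" where "alg_theta = vector [0, 0, 1]"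

definition alg_mult :: "real cubic_form \<Rightarrow> real^3 \<Rightarrow> real^3 \<Rightarrow> real^3" where
  "alg_mult f x y =
    (x$1 * y$1) *\<^sub>R alg_one + (x$1 * y$2 + x$2 * y$1) *\<^sub>R alg_omega
    + (x$1 * y$3 + x$3 * y$1) *\<^sub>R alg_theta
    + (x$2 * y$3 + x$3 * y$2) *\<^sub>R (- (ca f * cd f)) *\<^sub>R alg_one
    + (x$2 * y$2) *\<^sub>R (- (ca f * cc f) *\<^sub>R alg_one + cb f *\<^sub>R alg_omega - ca f *\<^sub>R alg_theta)
    + (x$3 * y$3) *\<^sub>R (- (cb f * cd f) *\<^sub>R alg_one + cd f *\<^sub>R alg_omega - cc f *\<^sub>R alg_theta)"

definition alg_trace :: "real cubic_form \<Rightarrow> real^3 \<Rightarrow> real" where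
  "alg_trace f x = trace (matrix (alg_mult f x))"

definition trace_free :: "real cubic_form \<Rightarrow> real^3 \<Rightarrow> real^3" where
  "trace_free f x = x - (alg_trace f x / 3) *\<^sub>R alg_one"

definition shape_pos :: "real cubic_form \<Rightarrow> complex" where
  "shape_pos f =
    (let w = trace_free f alg_omega; h = trace_free f alg_theta;
         A = alg_trace f (alg_mult f w w);
         B = alg_trace f (alg_mult f w h);
         C = alg_trace f (alg_mult f h h)
     in (of_real B + \<i> * of_real (sqrt (A * C - B^2))) / of_real A)"

text \<open>Isomorphisms of real algebras onto $\mathbf R\oplus\mathbf C$. For negative discriminant
  there are exactly two, exchanged by complex conjugation.\<close>

definition alg_iso :: "real cubic_form \<Rightarrow> (real^3 \<Rightarrow> real \<times> complex) \<Rightarrow> bool" where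
  "alg_iso f \<phi> \<longleftrightarrow> linear \<phi> \<and> bij \<phi> \<and> \<phi> alg_one = (1, 1) \<and>
    (\<forall>x y. \<phi> (alg_mult f x y) = (fst (\<phi> x) * fst (\<phi> y), snd (\<phi> x) * snd (\<phi> y)))"

text \<open>The identification $(\mathbf R\oplus\mathbf C)/\mathbf R(1,1)\simeq\mathbf C$ is the inverse
  of the one induced by $z\mapsto(0,z)$.\<close>

definition mod_diag :: "real \<times> complex \<Rightarrow> complex" where
  "mod_diag p = snd p - of_real (fst p)"

definition shape_neg :: "real cubic_form \<Rightarrow> complex" where
  "shape_neg f =
    (let \<tau> = (\<lambda>\<phi>. mod_diag (\<phi> alg_theta) / mod_diag (\<phi> alg_omega))
     in \<tau> (SOME \<phi>. alg_iso f \<phi> \<and> Im (\<tau> \<phi>) > 0))"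

definition shape :: "real cubic_form \<Rightarrow> complex" where
  "shape f = (if disc f > 0 then shape_pos f else shape_neg f)"


section \<open>The fundamental domain\<close>

definition n_mat :: "'a::comm_ring_1 \<Rightarrow> 'a^2^2" where
  "n_mat u = vector [vector [1, 0], vector [u, 1]]"

definition a_mat :: "real \<Rightarrow> real^2^2" where
  "a_mat t = vector [vector [inverse t, 0], vector [0, t]]"

definition SO2 :: "(real^2^2) set" where
  "SO2 = {k. orthogonal_matrix k \<and> det k = 1}"

definition t0 :: real where
  "t0 = root 4 3 / sqrt 2"

text \<open>Below height 1, which boundary points the ranges of \<open>u\<close> contain is a matter of convention,
  so only what lies between the open and the closed region is prescribed. Such a \<open>\<nu> t\<close> is
  automatically a union of at most two intervals.\<close>

definition gauss_range :: "(real \<Rightarrow> real set) \<Rightarrow> bool" where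
  "gauss_range \<nu> \<longleftrightarrow> (\<forall>t\<ge>t0.
     {u. -1/2 < u \<and> u < 1/2 \<and> u^2 + t^4 > 1} \<subseteq> \<nu> t \<and>
     \<nu> t \<subseteq> {u \<in> {-1/2..1/2}. u^2 + t^4 \<ge> 1} \<and>
     (t \<ge> 1 \<longrightarrow> \<nu> t = {-1/2..1/2}))"

definition fund_dom :: "(real \<Rightarrow> real set) \<Rightarrow> (real^2^2) set" where
  "fund_dom \<nu> = {n_mat u ** a_mat t ** k ** mat l | u t k l.
     u \<in> \<nu> t \<and> t \<ge> t0 \<and> k \<in> SO2 \<and> l > 0}"

definition fund_dom_cusp :: "(real \<Rightarrow> real set) \<Rightarrow> real \<Rightarrow> (real^2^2) set" where
  "fund_dom_cusp \<nu> T = {n_mat u ** a_mat t ** k ** mat l | u t k l.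
     u \<in> \<nu> t \<and> t \<ge> t0 \<and> k \<in> SO2 \<and> l > 0 \<and> t > T}"


section \<open>Weierstrass models and counts\<close>

definition primitive :: "int^2 \<Rightarrow> bool" where
  "primitive P \<longleftrightarrow> coprime (P$1) (P$2)"

text \<open>The triple \<open>(u, A, B)\<close> stands for the equation $y^2=x^3+ux^2+Ax+B$.
  The division by 3 below is exact, and the choice of \<open>M\<close> does not affect the result.\<close>

type_synonym weierstrass_eq = "int \<times> int \<times> int"

definition model :: "int cubic_form \<Rightarrow> int^2 \<Rightarrow> weierstrass_eq" where
  "model f P =
    (let M = (SOME M :: int^2^2. det M = 1 \<and> row 1 M = P);
         b = cb (subst_form M f);
         u = b mod 3;
         k = (u - b) div 3;
         F = subst_form (n_mat k) (subst_form M f)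
     in (u, cc F, cd F))"

text \<open>For a set \<open>G\<close> of matrices, the forms in the orbit piece \<open>G v\<close> taking the value 1 at \<open>P\<close>.
  Multiplicities of the orbit map are dropped, since only the set of distinct models is counted.\<close>

definition forms_at ::
  "(real^2^2) set \<Rightarrow> nat \<Rightarrow> real cubic_form \<Rightarrow> real \<Rightarrow> real \<Rightarrow> int^2 \<Rightarrow> real \<Rightarrow> int cubic_form set"
  where
  "forms_at G i v cm cp P X =
    {f \<in> V_int_irr i. real_form f \<in> (\<lambda>g. twisted_act g v) ` G \<and> eval_form f P = 1 \<and>
       cm * X \<le> \<bar>real_of_int (disc f)\<bar> \<and> \<bar>real_of_int (disc f)\<bar> < cp * X}"

definition model_count ::
  "(real^2^2) set \<Rightarrow> nat \<Rightarrow> real cubic_form \<Rightarrow> real \<Rightarrow> real \<Rightarrow> int^2 \<Rightarrow> real \<Rightarrow> nat" where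
  "model_count G i v cm cp P X = card ((\<lambda>f. model f P) ` forms_at G i v cm cp P X)"

definition cusp_ratio ::
  "(real \<Rightarrow> real set) \<Rightarrow> nat \<Rightarrow> real cubic_form \<Rightarrow> real \<Rightarrow> real \<Rightarrow> int^2 \<Rightarrow> real \<Rightarrow> real \<Rightarrow> real" where
  "cusp_ratio \<nu> i v cm cp P T X =
    real (model_count (fund_dom_cusp \<nu> T) i v cm cp P X)
      / real (model_count (fund_dom \<nu>) i v cm cp P X)"

end

theory Submission
  imports Defs
begin

text \<open>Write \<open>Y = X\<^sup>1\<^sup>/\<^sup>4\<close>. A form \<open>n(u) a(t) k \<lambda> v\<close> with discriminant of size \<open>X\<close> has \<open>\<lambda>\<close> of size \<open>Y\<close> and
  coefficients of sizes \<open>Y/t\<^sup>3, Y/t, Y t, Y t\<^sup>3\<close>. An irreducible integral form has \<open>a \<noteq> 0\<close>, hence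
  \<open>t\<^sup>3 \<lesssim> Y\<close>.

  For \<open>P = (\<plusminus>1, 0)\<close> the condition \<open>f(P) = 1\<close> fixes \<open>a\<close>, so that only \<open>O\<^sub>T(Y\<^sup>3)\<close> forms have \<open>t \<le> T\<close>. On
  the other hand there are at least \<open>X\<^sup>5\<^sup>/\<^sup>6\<close> models up to a constant: the models \<open>(0, A, B)\<close> with \<open>A\<close>
  of size \<open>X\<^sup>1\<^sup>/\<^sup>3\<close>, \<open>B\<close> of size \<open>X\<^sup>1\<^sup>/\<^sup>2\<close> and \<open>(A, B)\<close> in a suitable box all occur, since translations bring
  such forms into the Siegel set without changing the model.

  For other \<open>P\<close> the condition \<open>f(P) = 1\<close> determines \<open>d\<close>, so that the number of forms with \<open>t > T\<close> is
  \<open>O(Y\<^sup>3/T)\<close>. Here the cone of forms reached by the Siegel set meets the plane \<open>f(P) = 0\<close> in an open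
  set, which yields at least \<open>Y\<^sup>3\<close> models up to a constant.

  In both lower bounds irreducibility is ensured by a congruence modulo 2.\<close>

section \<open>Substitution in cubic forms\<close>

definition mat2 :: "'a::zero \<Rightarrow> 'a \<Rightarrow> 'a \<Rightarrow> 'a \<Rightarrow> 'a^2^2" where
  "mat2 p q r s = vector [vector [p, q], vector [r, s]]"

lemma mat2_nth [simp]:
  "mat2 p q r s $ 1 $ 1 = p" "mat2 p q r s $ 1 $ 2 = q"
  "mat2 p q r s $ 2 $ 1 = r" "mat2 p q r s $ 2 $ 2 = s"
  by (simp_all add: mat2_def)

lemma mat2_eta: "mat2 (g$1$1) (g$1$2) (g$2$1) (g$2$2) = g"
  by (simp add: vec_eq_iff forall_2)

lemma mat2_exhaust:
  obtains p q r s where "g = mat2 p q r s"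
  by (metis mat2_eta)

lemma mat2_mult:
  "mat2 p q r s ** mat2 p' q' r' s' =
    mat2 (p * p' + q * r') (p * q' + q * s') (r * p' + s * r') (r * q' + s * (s'::'a::semiring_1))"
  by (simp add: vec_eq_iff forall_2 matrix_matrix_mult_def sum_2)

lemma det_mat2: "det (mat2 p q r s) = p * s - q * (r::'a::comm_ring_1)"
  by (simp add: det_2)

lemma subst_form_mat2:
  "subst_form (mat2 p q r s) (Cubic a b c d) =
     Cubic (a * p^3 + b * p^2 * q + c * p * q^2 + d * q^3)
           (3 * a * p^2 * r + b * (p^2 * s + 2 * p * q * r) + c * (2 * p * q * s + q^2 * r)
              + 3 * d * q^2 * s)
           (3 * a * p * r^2 + b * (2 * p * r * s + q * r^2) + c * (p * s^2 + 2 * q * r * s)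
              + 3 * d * q * s^2)
           (a * r^3 + b * r^2 * s + c * r * s^2 + d * s^3)"
  by (simp add: subst_form_def Let_def)

text \<open>Because \<open>(X, Y)\<close> is a row vector, the iterated substitution evaluates
  \<open>f\<close> at \<open>(X, Y) g h\<close>, so this is a left action.\<close>

lemma subst_form_mult:
  "subst_form g (subst_form h f) = subst_form (g ** h) (f :: 'a::idom cubic_form)"
proof -
  obtain p q r s where g: "g = mat2 p q r s" by (rule mat2_exhaust)
  obtain p' q' r' s' where h: "h = mat2 p' q' r' s'" by (rule mat2_exhaust)
  obtain a b c d where f: "f = Cubic a b c d" by (cases f)
  show ?thesis
    unfolding g h f mat2_mult subst_form_mat2 cubic_form.inject
    by (intro conjI; algebra)
qed

text \<open>An invariant of degree 4 of binary cubic forms has weight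
  \<open>4 * 3 / 2 = 6\<close>.\<close>

lemma disc_subst_form: "disc (subst_form g f) = det g ^ 6 * disc (f :: 'a::idom cubic_form)"
proof -
  obtain p q r s where g: "g = mat2 p q r s" by (rule mat2_exhaust)
  obtain a b c d where f: "f = Cubic a b c d" by (cases f)
  show ?thesis
    unfolding g f det_mat2 subst_form_mat2 disc_def cubic_form.sel
    by algebra
qed

section \<open>Openness of orbits\<close>

lemma continuous_on_mat2 [continuous_intros]:
  fixes p q r s :: "'a::topological_space \<Rightarrow> real"
  assumes "continuous_on S p" "continuous_on S q" "continuous_on S r" "continuous_on S s"
  shows "continuous_on S (\<lambda>x. mat2 (p x) (q x) (r x) (s x))"
proof -
  have "continuous_on S (\<lambda>x. mat2 (p x) (q x) (r x) (s x) $ i $ j)" for i j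
    using assms exhaust_2[of i] exhaust_2[of j] by auto
  then have "continuous_on S (\<lambda>x. \<chi> i j. mat2 (p x) (q x) (r x) (s x) $ i $ j)"
    by (intro continuous_on_vec_lambda)
  then show ?thesis
    by simp
qed

text \<open>The derivative of \<open>g \<mapsto> f((X, Y) g)\<close> at the identity is \<open>h \<mapsto> (h\<^sub>1\<^sub>1 X + h\<^sub>2\<^sub>1 Y) f\<^sub>X + (h\<^sub>1\<^sub>2 X + h\<^sub>2\<^sub>2 Y) f\<^sub>Y\<close>.
  Its determinant \<open>D\<close> is a Sylvester determinant of \<open>f\<^sub>X, f\<^sub>Y\<close>, and \<open>G\<close> is its inverse by Cramer's rule.\<close>

lemma open_orbit_one:
  fixes a b c d :: real
  assumes disc: "disc (Cubic a b c d) \<noteq> 0" and "open T" and T: "(1, 0, 0, 1) \<in> T"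
  shows "(a, b, c, d) \<in> interior ((\<lambda>(p, q, r, s). case subst_form (mat2 p q r s) (Cubic a b c d)
           of Cubic a b c d \<Rightarrow> (a, b, c, d)) ` T)"
proof -
  define \<Phi> :: "real \<times> real \<times> real \<times> real \<Rightarrow> real \<times> real \<times> real \<times> real" where
    "\<Phi> = (\<lambda>x.
      (a * fst x^3 + b * fst x^2 * fst (snd x) + c * fst x * fst (snd x)^2 + d * fst (snd x)^3,
       3 * a * fst x^2 * fst (snd (snd x))
         + b * (fst x^2 * snd (snd (snd x)) + 2 * fst x * fst (snd x) * fst (snd (snd x)))
         + c * (2 * fst x * fst (snd x) * snd (snd (snd x)) + fst (snd x)^2 * fst (snd (snd x)))
         + 3 * d * fst (snd x)^2 * snd (snd (snd x)),
       3 * a * fst x * fst (snd (snd x))^2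
         + b * (2 * fst x * fst (snd (snd x)) * snd (snd (snd x)) + fst (snd x) * fst (snd (snd x))^2)
         + c * (fst x * snd (snd (snd x))^2 + 2 * fst (snd x) * fst (snd (snd x)) * snd (snd (snd x)))
         + 3 * d * fst (snd x) * snd (snd (snd x))^2,
       a * fst (snd (snd x))^3 + b * fst (snd (snd x))^2 * snd (snd (snd x)) + c * fst (snd (snd x)) * snd (snd (snd x))^2 + d * snd (snd (snd x))^3))"
  have \<Phi>: "(\<lambda>(p, q, r, s). case subst_form (mat2 p q r s) (Cubic a b c d)
           of Cubic a b c d \<Rightarrow> (a, b, c, d)) = \<Phi>"
    by (auto simp: \<Phi>_def subst_form_mat2 fun_eq_iff)
  define L :: "real \<times> real \<times> real \<times> real \<Rightarrow> real \<times> real \<times> real \<times> real" where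
    "L = (\<lambda>h. (3 * a * fst h + b * fst (snd h),
      2 * b * fst h + 3 * a * fst (snd (snd h)) + 2 * c * fst (snd h) + b * snd (snd (snd h)),
      c * fst h + 2 * b * fst (snd (snd h)) + 3 * d * fst (snd h) + 2 * c * snd (snd (snd h)),
      c * fst (snd (snd h)) + 3 * d * snd (snd (snd h))))"
  define D where "D = 54*a*b*c*d - 12*a*c^3 - 81*a^2*d^2 - 12*b^3*d + 3*b^2*c^2"
  have D: "D = 3 * disc (Cubic a b c d)"
    by (simp add: D_def disc_def)
  define G :: "real \<times> real \<times> real \<times> real \<Rightarrow> real \<times> real \<times> real \<times> real" where
    "G = (\<lambda>e. (
      (fst e*(15*b*c*d - 4*c^3 - 27*a*d^2) + fst (snd e)*(- 6*b^2*d + 2*b*c^2)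
        + fst (snd (snd e))*(9*a*b*d - b^2*c) + snd (snd (snd e))*(- 6*a*b*c + 2*b^3)) / D,
      (fst e*(-12*b^2*d + 3*b*c^2 + 9*a*c*d) + fst (snd e)*(18*a*b*d - 6*a*c^2)
        + fst (snd (snd e))*(-27*a^2*d + 3*a*b*c) + snd (snd (snd e))*(18*a^2*c - 6*a*b^2)) / D,
      (fst e*(18*b*d^2 - 6*c^2*d) + fst (snd e)*(-27*a*d^2 + 3*b*c*d)
        + fst (snd (snd e))*(18*a*c*d - 6*b^2*d) + snd (snd (snd e))*(-12*a*c^2 + 9*a*b*d + 3*b^2*c)) / D,
      (fst e*(-6*b*c*d + 2*c^3) + fst (snd e)*(9*a*c*d - b*c^2)
        + fst (snd (snd e))*(-6*a*c^2 + 2*b^2*c) + snd (snd (snd e))*(15*a*b*c - 27*a^2*d - 4*b^3)) / D))"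
  have "D \<noteq> 0" using disc D by simp
  \<comment> \<open>\<open>sussmann_open_mapping\<close> takes a bounded linear right inverse of the
    derivative and concludes that the image point is interior.\<close>
  have "L \<circ> G = id"
  proof (rule ext)
    fix e :: "real \<times> real \<times> real \<times> real"
    obtain e1 e2 e3 e4 where e: "e = (e1, e2, e3, e4)" by (cases e)
    show "(L \<circ> G) e = id e"
      using \<open>D \<noteq> 0\<close> unfolding e L_def G_def
      by (simp add: divide_simps, simp add: D_def) (intro conjI; algebra)
  qed
  moreover have "bounded_linear G"
    unfolding G_def
    by (intro bounded_linear_Pair bounded_linear_add bounded_linear_mult_const
         bounded_linear_compose[OF bounded_linear_divide] bounded_linear_fst bounded_linear_snd
         bounded_linear_compose[OF bounded_linear_fst]
         bounded_linear_compose[OF bounded_linear_snd])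
  moreover have "(\<Phi> has_derivative L) (at (1, 0, 0, 1))"
    unfolding \<Phi>_def L_def
    by (intro has_derivative_Pair)
       ((rule derivative_eq_intros refl)+, simp add: fun_eq_iff algebra_simps)+
  moreover have "continuous_on UNIV \<Phi>"
    unfolding \<Phi>_def by (intro continuous_intros)
  moreover have "(1, 0, 0, 1) \<in> interior T"
    using T \<open>open T\<close> by (simp add: interior_open)
  ultimately have "\<Phi> (1, 0, 0, 1) \<in> interior (\<Phi> ` T)"
    by (intro sussmann_open_mapping[where S = UNIV and f' = L and g' = G]) auto
  then show ?thesis
    unfolding \<Phi> by (simp add: \<Phi>_def)
qed

text \<open>Openness at \<open>g0\<close> is openness at the identity for the form
  \<open>subst_form g0 v\<close>: matrices near \<open>g0\<close> are \<open>h ** g0\<close> with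
  \<open>h\<close> near 1, and substitution is multiplicative.\<close>

lemma open_orbit:
  fixes v :: "real cubic_form"
  assumes v: "disc v \<noteq> 0" and U: "open U" "g0 \<in> U" and g0: "det g0 \<noteq> 0"
    and w: "subst_form g0 v = Cubic a0 b0 c0 d0"
  obtains \<epsilon> where "\<epsilon> > 0"
    "\<And>a b c d. \<lbrakk>\<bar>a - a0\<bar> < \<epsilon>; \<bar>b - b0\<bar> < \<epsilon>; \<bar>c - c0\<bar> < \<epsilon>; \<bar>d - d0\<bar> < \<epsilon>\<rbrakk>
       \<Longrightarrow> \<exists>g\<in>U. subst_form g v = Cubic a b c d"
proof -
  define T where "T = (\<lambda>(p, q, r, s). mat2 p q r s ** g0) -` U"
  have "continuous_on UNIV (\<lambda>(p, q, r, s). mat2 p q r s ** g0)"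
  proof -
    obtain p' q' r' s' where h: "g0 = mat2 p' q' r' s'" by (rule mat2_exhaust)
    show ?thesis
      unfolding h mat2_mult case_prod_unfold by (intro continuous_intros)
  qed
  then have "open T"
    unfolding T_def using U(1) open_vimage by blast
  moreover have "mat2 1 0 0 1 = (mat 1 :: real^2^2)"
    by (simp add: vec_eq_iff forall_2 mat_def)
  then have "(1, 0, 0, 1) \<in> T"
    using U(2) by (simp add: T_def)
  moreover have "disc (Cubic a0 b0 c0 d0) \<noteq> 0"
    unfolding w[symmetric] disc_subst_form using v g0 by simp
  ultimately have "(a0, b0, c0, d0) \<in> interior ((\<lambda>(p, q, r, s).
      case subst_form (mat2 p q r s) (Cubic a0 b0 c0 d0) of Cubic a b c d \<Rightarrow> (a, b, c, d)) ` T)"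
    by (intro open_orbit_one)
  then obtain e where e: "e > 0" "ball (a0, b0, c0, d0) e \<subseteq> (\<lambda>(p, q, r, s).
      case subst_form (mat2 p q r s) (Cubic a0 b0 c0 d0) of Cubic a b c d \<Rightarrow> (a, b, c, d)) ` T"
    by (auto simp: mem_interior)
  show ?thesis
  proof (rule that[of "e / 4"])
    fix a b c d :: real
    assume *: "\<bar>a - a0\<bar> < e / 4" "\<bar>b - b0\<bar> < e / 4" "\<bar>c - c0\<bar> < e / 4" "\<bar>d - d0\<bar> < e / 4"
    \<comment> \<open>The product distance is at most the sum of the four coordinate distances,
      hence the choice of \<open>e / 4\<close>.\<close>
    have "dist (a0, b0, c0, d0) (a, b, c, d) \<le> dist a0 a + dist (b0, c0, d0) (b, c, d)"
      "dist (b0, c0, d0) (b, c, d) \<le> dist b0 b + dist (c0, d0) (c, d)"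
      "dist (c0, d0) (c, d) \<le> dist c0 c + dist d0 d"
      by (simp_all only: dist_Pair_Pair[of a0] dist_Pair_Pair[of b0] dist_Pair_Pair[of c0]
            sqrt_sum_squares_le_sum zero_le_dist real_sqrt_ge_zero add_nonneg_nonneg zero_le_power2)
    moreover have "dist a0 a + dist b0 b + dist c0 c + dist d0 d < e"
      using * unfolding dist_real_def by linarith
    ultimately have "dist (a0, b0, c0, d0) (a, b, c, d) < e"
      by linarith
    then have "(a, b, c, d) \<in> (\<lambda>(p, q, r, s).
      case subst_form (mat2 p q r s) (Cubic a0 b0 c0 d0) of Cubic a b c d \<Rightarrow> (a, b, c, d)) ` T"
      using e by auto
    then obtain p q r s where "mat2 p q r s ** g0 \<in> U"
      "(case subst_form (mat2 p q r s) (Cubic a0 b0 c0 d0) of Cubic a b c d \<Rightarrow> (a, b, c, d)) = (a, b, c, d)"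
      by (auto simp: T_def)
    moreover from this have "subst_form (mat2 p q r s) (Cubic a0 b0 c0 d0) = Cubic a b c d"
      by (auto split: cubic_form.splits)
    ultimately show "\<exists>g\<in>U. subst_form g v = Cubic a b c d"
      by (metis subst_form_mult w)
  qed (use e in auto)
qed

section \<open>A Siegel set inside the fundamental domain\<close>

lemma n_mat_eq: "n_mat u = mat2 1 0 u 1"
  and a_mat_eq: "a_mat t = mat2 (inverse t) 0 0 t"
  and mat_eq_mat2: "mat l = mat2 l 0 0 l"
  by (simp_all add: n_mat_def a_mat_def mat2_def vec_eq_iff forall_2 mat_def)

lemma t0_bounds: "1/2 \<le> t0" "t0 \<le> 1"
proof -
  have "root 4 3 \<le> root 4 4" by simp
  also have "root 4 (4::real) = sqrt 2"
    by (intro real_root_pos_unique) (auto simp: power4_eq_xxxx)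
  finally show "t0 \<le> 1"
    by (simp add: t0_def)
  have "1 \<le> root 4 (3::real)" by simp
  moreover have "sqrt 2 \<le> (2::real)"
    by (rule real_le_lsqrt) auto
  ultimately show "1/2 \<le> t0"
    unfolding t0_def by (simp only: pos_le_divide_eq real_sqrt_gt_zero zero_less_numeral)
qed

text \<open>For \<open>g = n(u) a(t) k \<lambda>\<close> with rows \<open>r\<^sub>1, r\<^sub>2\<close> one has \<open>u = r\<^sub>1 \<cdot> r\<^sub>2 / \<bar>r\<^sub>1\<bar>\<^sup>2\<close> and \<open>t\<^sup>2 = det g / \<bar>r\<^sub>1\<bar>\<^sup>2\<close>, so the
  conditions say \<open>\<bar>u\<bar> \<le> 1/2\<close> and \<open>t \<ge> 1\<close>.\<close>

definition siegel_cone :: "(real^2^2) set" where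
  "siegel_cone = {g. det g > 0 \<and> 2 * \<bar>g$1$1 * g$2$1 + g$1$2 * g$2$2\<bar> \<le> (g$1$1)^2 + (g$1$2)^2
     \<and> (g$1$1)^2 + (g$1$2)^2 \<le> det g}"

text \<open>Iwasawa decomposition by Gram-Schmidt: \<open>l\<close> is the square root of the
  determinant, \<open>t\<close> is \<open>l\<close> over the length of the first row, and
  \<open>k\<close> is the rotation whose first row is the normalised first row of \<open>g\<close>.
  The cone forces \<open>t >= 1\<close>, where \<open>gauss_range\<close> admits every
  \<open>u\<close> with \<open>|u| <= 1/2\<close>.\<close>

lemma siegel_cone_subset_fund_dom:
  assumes "gauss_range \<nu>"
  shows "siegel_cone \<subseteq> fund_dom \<nu>"
proof
  fix g assume g: "g \<in> siegel_cone"
  obtain p q r s where pq: "g = mat2 p q r s" by (rule mat2_exhaust)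
  define N where "N = p^2 + q^2"
  define D where "D = p * s - q * r"
  have D: "D > 0" and N: "N \<le> D" and u2: "2 * \<bar>p * r + q * s\<bar> \<le> N"
    using g unfolding siegel_cone_def pq by (simp_all add: det_mat2 N_def D_def)
  have "p \<noteq> 0 \<or> q \<noteq> 0"
    using D by (auto simp: D_def)
  then have "N > 0"
    by (simp add: N_def sum_power2_gt_zero_iff)
  define l where "l = sqrt D"
  define n where "n = sqrt N"
  have l: "l > 0" "l^2 = D" and n: "n > 0" "n^2 = N" "n \<le> l"
    using D N \<open>N > 0\<close> by (auto simp: l_def n_def)
  define t where "t = l / n"
  define k where "k = mat2 (p / n) (q / n) (- q / n) (p / n)"
  have "t \<ge> 1"
    using n by (simp add: t_def)
  define u where "u = (p * r + q * s) / N"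
  have "\<bar>u\<bar> \<le> 1/2"
    using u2 \<open>N > 0\<close> by (simp add: u_def field_simps)
  then have "u \<in> {-1/2..1/2}"
    by auto
  moreover have "\<nu> t = {-1/2..1/2}" "t \<ge> t0"
    using assms t0_bounds \<open>t \<ge> 1\<close> by (simp_all add: gauss_range_def)
  ultimately have "(p * r + q * s) / N \<in> \<nu> t" "t \<ge> t0"
    by (simp_all add: u_def)
  have nn: "(p^2 + q^2) / n^2 = 1"
    unfolding n(2) N_def[symmetric] using \<open>N > 0\<close> by simp
  have "k ** transpose k = mat 1"
    using nn by (simp add: k_def vec_eq_iff forall_2 matrix_matrix_mult_def sum_2 transpose_def mat_def
       power2_eq_square add_divide_distrib)
  moreover have "det k = (p^2 + q^2) / n^2"
    by (simp add: k_def det_mat2 power2_eq_square add_divide_distrib)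
  ultimately have "k \<in> SO2"
    using nn by (simp add: SO2_def orthogonal_matrix_def matrix_left_right_inverse)
  moreover have "g = n_mat ((p * r + q * s) / N) ** a_mat t ** k ** mat l"
  proof -
    have 1: "inverse t * (x / n) * l = x" for x
      using l n by (simp add: t_def)
    \<comment> \<open>The second row is \<open>u\<close> times the first row plus
      \<open>D / N\<close> times the first row turned by a right angle.\<close>
    have 2: "(p * r + q * s) / N * p - D / N * q = r" "(p * r + q * s) / N * q + D / N * p = s"
      using \<open>N > 0\<close> by (simp_all add: field_simps, simp_all add: N_def D_def algebra_simps power2_eq_square)
    have 3: "t * (x / n) * l = D / N * x" for x
      using l n by (simp add: t_def power2_eq_square flip: l(2) n(2))
    have "(u * inverse t * (p / n) + t * (- q / n)) * l = u * (inverse t * (p / n) * l) - t * (q / n) * l"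
      "(u * inverse t * (q / n) + t * (p / n)) * l = u * (inverse t * (q / n) * l) + t * (p / n) * l"
      by (simp_all add: algebra_simps)
    then have "(u * inverse t * (p / n) + t * (- q / n)) * l = r"
      "(u * inverse t * (q / n) + t * (p / n)) * l = s"
      unfolding 1 3 using 2 by (simp_all add: u_def)
    then show ?thesis
      unfolding pq n_mat_eq a_mat_eq mat_eq_mat2 k_def mat2_mult
      using 1[of p] 1[of q] by (simp add: u_def[symmetric])
  qed
  ultimately show "g \<in> fund_dom \<nu>"
    unfolding fund_dom_def using l(1) \<open>(p * r + q * s) / N \<in> \<nu> t\<close> \<open>t \<ge> t0\<close> by blast
qed

text \<open>A scalar factor \<open>l\<close> on \<open>g\<close> multiplies the substituted form by
  \<open>l^3\<close> and the determinant by \<open>l^2\<close>, so the twisted form is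
  \<open>l / det g\<close> times \<open>subst_form g v\<close>. Taking \<open>l = c * det g\<close>
  realises any positive factor \<open>c\<close>, and the cone is stable under such scaling.\<close>

lemma siegel_cone_orbit:
  assumes "gauss_range \<nu>" "g \<in> siegel_cone" "c > 0"
  shows "map_cubic_form ((*) c) (subst_form g v) \<in> (\<lambda>g. twisted_act g v) ` fund_dom \<nu>"
proof -
  obtain p q r s where pq: "g = mat2 p q r s" by (rule mat2_exhaust)
  define l where "l = c * det g"
  have D: "det g > 0"
    using assms by (simp add: siegel_cone_def)
  have l: "l > 0"
    using assms D by (simp add: l_def)
  have "mat2 (l * p) (l * q) (l * r) (l * s) \<in> siegel_cone"
  proof -
    have *: "(l * x) * (l * y) = l^2 * (x * y)" "(l * x)^2 = l^2 * x^2" for x y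
      by (simp_all add: power2_eq_square)
    show ?thesis
      using assms(2) l unfolding siegel_cone_def pq
      by (simp add: det_mat2 * zero_less_mult_iff flip: right_diff_distrib distrib_left)
         (simp add: abs_mult)
  qed
  moreover have "twisted_act (mat2 (l * p) (l * q) (l * r) (l * s)) v = map_cubic_form ((*) c) (subst_form g v)"
  proof -
    obtain a1 b1 c1 d1 where v: "v = Cubic a1 b1 c1 d1" by (cases v)
    have "inverse (l * p * (l * s) - l * q * (l * r)) * l^3 = l / det g"
      using D l by (simp add: pq det_mat2 field_simps power3_eq_cube)
    also have "\<dots> = c"
      using D by (simp add: l_def)
    finally have *: "inverse (l * p * (l * s) - l * q * (l * r)) * (l^3 * x) = c * x" for x
      by (metis mult.assoc)
    have "subst_form (mat2 (l * p) (l * q) (l * r) (l * s)) v = map_cubic_form ((*) (l^3)) (subst_form g v)"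
      unfolding v pq subst_form_mat2 cubic_form.map cubic_form.inject
      by (intro conjI; algebra)
    then show ?thesis
      by (cases "subst_form g v") (simp add: twisted_act_def det_mat2 *)
  qed
  ultimately show ?thesis
    using siegel_cone_subset_fund_dom[OF assms(1)] by (metis image_eqI subsetD)
qed

section \<open>Open boxes of real forms that are reached from the base form\<close>

lemma exists_scale_between:
  fixes D lo hi :: real
  assumes "D > 0" "0 < lo" "lo < hi"
  obtains \<mu> where "\<mu> > 0" "lo < \<mu>^6 * D" "\<mu>^6 * D < hi"
proof (rule that[of "root 6 ((lo + hi) / 2 / D)"])
  have "(root 6 ((lo + hi) / 2 / D))^6 = (lo + hi) / 2 / D"
    using assms by (intro real_root_pow_pos2) auto
  then have "(root 6 ((lo + hi) / 2 / D))^6 * D = (lo + hi) / 2"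
    using assms by simp
  then show "lo < (root 6 ((lo + hi) / 2 / D))^6 * D" "(root 6 ((lo + hi) / 2 / D))^6 * D < hi"
    using assms by simp_all
qed (use assms in auto)

text \<open>A cubic form changes sign under \<open>w -> -w\<close>, so it vanishes somewhere on a
  half circle. In \<open>cone_neighbourhood\<close> the point \<open>P\<close> is moved onto such a
  zero.\<close>

lemma exists_real_zero:
  fixes a b c d :: real
  obtains x y where "x^2 + y^2 = 1" "a * x^3 + b * x^2 * y + c * x * y^2 + d * y^3 = 0"
proof -
  define h where "h \<theta> = a * cos \<theta>^3 + b * cos \<theta>^2 * sin \<theta> + c * cos \<theta> * sin \<theta>^2 + d * sin \<theta>^3" for \<theta>
  have h: "h pi = - h 0"
    by (simp add: h_def)
  have cont: "continuous_on {0..pi} h"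
    unfolding h_def by (intro continuous_intros)
  have "\<exists>\<theta>. h \<theta> = 0"
  proof (cases "h 0 \<le> 0")
    case True
    then show ?thesis
      using IVT'[of h 0 0 pi] h cont by auto
  next
    case False
    then show ?thesis
      using IVT2'[of h pi 0 0] h cont by auto
  qed
  then obtain \<theta> where "h \<theta> = 0" ..
  then show ?thesis
    by (intro that[of "cos \<theta>" "sin \<theta>"]) (auto simp: h_def)
qed

text \<open>A form of nonzero discriminant is not identically zero, and a real cube root rescales
  any nonzero value to 1.\<close>

lemma exists_value_one:
  fixes a b c d :: real
  assumes "disc (Cubic a b c d) \<noteq> 0"
  obtains x y where "a * x^3 + b * x^2 * y + c * x * y^2 + d * y^3 = 1"
proof -
  define h where "h x y = a * x^3 + b * x^2 * y + c * x * y^2 + d * y^3" for x y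
  have "\<exists>x y. h x y \<noteq> 0"
  proof (rule ccontr)
    assume "\<not> ?thesis"
    \<comment> \<open>Vanishing at these four points forces all four coefficients to vanish.\<close>
    then have "h 1 0 = 0" "h 0 1 = 0" "h 1 1 = 0" "h 1 (-1) = 0" by auto
    then have "a = 0" "b = 0" "c = 0" "d = 0" by (simp_all add: h_def)
    then show False using assms by (simp add: disc_def)
  qed
  then obtain x y where xy: "h x y \<noteq> 0" by blast
  define s where "s = root 3 (inverse (h x y))"
  have s: "s^3 = inverse (h x y)"
    by (simp add: s_def odd_real_root_pow)
  have "h (s * x) (s * y) = s^3 * h x y"
    unfolding h_def by algebra
  then show ?thesis
    using that[of "s * x" "s * y"] s xy by (simp add: h_def)
qed

text \<open>A first row at which \<open>v\<close> takes the value 1 makes the form monic; the second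
  row then removes the \<open>X^2 Y\<close> term and moves the discriminant into the window. By
  \<open>open_orbit\<close> this persists for all nearby \<open>A\<close>, \<open>B\<close>. The
  bound with \<open>R\<close> stands in for the height condition of the cone, which is reached later
  by stretching the second row.\<close>

lemma depressed_cubic_neighbourhood:
  fixes v :: "real cubic_form" and lo hi :: real
  assumes v: "disc v \<noteq> 0" and "0 < lo" "lo < hi"
  obtains A0 B0 \<eta> R where "\<eta> > 0"
    "\<And>A B. \<lbrakk>\<bar>A - A0\<bar> < \<eta>; \<bar>B - B0\<bar> < \<eta>\<rbrakk> \<Longrightarrow>
       \<exists>g. det g > 0 \<and> (g$1$1)^2 + (g$1$2)^2 \<le> R * det g \<and> subst_form g v = Cubic 1 0 A B
         \<and> lo < \<bar>disc (Cubic 1 0 A B)\<bar> \<and> \<bar>disc (Cubic 1 0 A B)\<bar> < hi"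
proof -
  obtain a b c d where vc: "v = Cubic a b c d" by (cases v)
  obtain p q where pq: "a * p^3 + b * p^2 * q + c * p * q^2 + d * q^3 = 1"
    using exists_value_one v vc by metis
  define N where "N = p^2 + q^2"
  have "p \<noteq> 0 \<or> q \<noteq> 0" using pq by auto
  then have N: "N > 0" by (simp add: N_def sum_power2_gt_zero_iff)
  obtain b1 c1 d1 where w: "subst_form (mat2 p q (-q) p) v = Cubic 1 b1 c1 d1"
    using pq by (simp add: vc subst_form_mat2)
  obtain \<mu> where \<mu>: "\<mu> > 0" "lo < \<mu>^6 * (N^6 * \<bar>disc v\<bar>)" "\<mu>^6 * (N^6 * \<bar>disc v\<bar>) < hi"
    using exists_scale_between[of "N^6 * \<bar>disc v\<bar>" lo hi] v N assms by auto
  \<comment> \<open>The entry \<open>- b1 * \<mu> / 3\<close> cancels the \<open>X^2 Y\<close>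
    coefficient, and \<open>\<mu>\<close> scales the determinant to
    \<open>\<mu> * N\<close>.\<close>
  define g0 where "g0 = mat2 1 0 (- b1 * \<mu> / 3) \<mu> ** mat2 p q (-q) p"
  obtain A0 B0 where g0: "subst_form g0 v = Cubic 1 0 A0 B0"
    unfolding g0_def subst_form_mult[symmetric] w by (simp add: subst_form_mat2)
  have det0: "det g0 = \<mu> * N"
    by (simp add: g0_def det_mul det_mat2 N_def power2_eq_square)
  \<comment> \<open>The summand 1 makes \<open>g0\<close> satisfy a strict inequality, as the open
    set \<open>U\<close> demands.\<close>
  define R where "R = ((g0$1$1)^2 + (g0$1$2)^2) / det g0 + 1"
  define U where "U = {g :: real^2^2. 0 < det g} \<inter> {g. (g$1$1)^2 + (g$1$2)^2 < R * det g}
     \<inter> {g. lo < det g^6 * \<bar>disc v\<bar>} \<inter> {g. det g^6 * \<bar>disc v\<bar> < hi}"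
  have "open U"
    unfolding U_def det_2 by (intro open_Int open_Collect_less continuous_intros)
  moreover have "g0 \<in> U"
    using det0 \<mu> N by (simp add: U_def R_def power_mult_distrib mult.assoc) (simp add: field_simps)
  ultimately obtain \<epsilon> where \<epsilon>: "\<epsilon> > 0"
    "\<And>a b c d. \<lbrakk>\<bar>a - 1\<bar> < \<epsilon>; \<bar>b - 0\<bar> < \<epsilon>; \<bar>c - A0\<bar> < \<epsilon>; \<bar>d - B0\<bar> < \<epsilon>\<rbrakk>
       \<Longrightarrow> \<exists>g\<in>U. subst_form g v = Cubic a b c d"
    using open_orbit[OF v _ _ _ g0] det0 \<mu>(1) N by (metis mult_pos_pos less_irrefl)
  show ?thesis
  proof (rule that[OF \<epsilon>(1)])
    fix A B assume "\<bar>A - A0\<bar> < \<epsilon>" "\<bar>B - B0\<bar> < \<epsilon>"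
    then obtain g where g: "g \<in> U" "subst_form g v = Cubic 1 0 A B"
      using \<epsilon>(2)[of 1 0 A B] \<epsilon>(1) by auto
    have "\<bar>disc (Cubic 1 0 A B)\<bar> = det g^6 * \<bar>disc v\<bar>"
      unfolding g(2)[symmetric] disc_subst_form by (simp add: abs_mult)
    then show "\<exists>g. det g > 0 \<and> (g$1$1)^2 + (g$1$2)^2 \<le> R * det g \<and> subst_form g v = Cubic 1 0 A B
         \<and> lo < \<bar>disc (Cubic 1 0 A B)\<bar> \<and> \<bar>disc (Cubic 1 0 A B)\<bar> < hi"
      using g by (intro exI[of _ g]) (auto simp: U_def)
  qed
qed

text \<open>In the application \<open>M\<close> has first row \<open>P\<close>, so the leading
  coefficient of \<open>subst_form (M ** g) v\<close> is the value of \<open>subst_form g v\<close>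
  at \<open>P\<close>. A point \<open>g0\<close> interior to the cone is built for which this value
  is 0; around it the leading coefficient takes all small values, as the rescaled condition
  \<open>f(P) = 1\<close> requires.\<close>

lemma cone_neighbourhood:
  fixes v :: "real cubic_form" and lo hi :: real and M M' :: "real^2^2"
  assumes v: "disc v \<noteq> 0" and "0 < lo" "lo < hi"
    and M: "det M = 1" "M' ** M = mat 1" and P: "M $ 1 $ 2 \<noteq> 0"
  obtains b0 c0 d0 \<eta> where "\<eta> > 0" "b0 \<noteq> 0"
    "\<And>a b c d. \<lbrakk>\<bar>a\<bar> < \<eta>; \<bar>b - b0\<bar> < \<eta>; \<bar>c - c0\<bar> < \<eta>; \<bar>d - d0\<bar> < \<eta>\<rbrakk> \<Longrightarrow>
       \<exists>g\<in>siegel_cone. subst_form M' (Cubic a b c d) = subst_form g v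
         \<and> lo < \<bar>disc (Cubic a b c d)\<bar> \<and> \<bar>disc (Cubic a b c d)\<bar> < hi"
proof -
  obtain a b c d where vc: "v = Cubic a b c d" by (cases v)
  obtain p q r s where pq: "M = mat2 p q r s" by (rule mat2_exhaust)
  obtain x y where xy: "x^2 + y^2 = 1" "a * x^3 + b * x^2 * y + c * x * y^2 + d * y^3 = 0"
    using exists_real_zero by blast
  have "q \<noteq> 0" using P pq by simp
  \<comment> \<open>The matrix \<open>g0\<close> below is \<open>a_mat 2\<close> times a rotation
    and a scalar, so \<open>u = 0\<close> and \<open>t = 2\<close>. Here \<open>(z1, z2)\<close> is
    \<open>(p, q)\<close> times \<open>a_mat 2\<close>, and \<open>C\<close>, \<open>S\<close> are,
    up to a factor \<open>sqrt K\<close>, cosine and sine of the rotation that turns it into the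
    direction of the zero \<open>(x, y)\<close>.\<close>
  define z1 where "z1 = p / 2"
  define z2 where "z2 = 2 * q"
  define C where "C = z1 * x + z2 * y"
  define S where "S = z1 * y - z2 * x"
  define K where "K = z1^2 + z2^2"
  have K: "K > 0" "C^2 + S^2 = K"
  proof -
    have "C^2 + S^2 = K * (x^2 + y^2)"
      unfolding C_def S_def K_def by algebra
    then show "C^2 + S^2 = K"
      using xy by simp
    show "K > 0"
      using \<open>q \<noteq> 0\<close> by (simp add: K_def z2_def add_nonneg_pos)
  qed
  obtain \<mu> where \<mu>: "\<mu> > 0" "lo < \<mu>^6 * (K^6 * \<bar>disc v\<bar>)" "\<mu>^6 * (K^6 * \<bar>disc v\<bar>) < hi"
    using exists_scale_between[of "K^6 * \<bar>disc v\<bar>" lo hi] v K assms by auto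
  define l where "l = sqrt \<mu>"
  have l: "l^2 = \<mu>"
    using \<mu> by (simp add: l_def)
  define g0 where "g0 = mat2 (l * C / 2) (l * S / 2) (- 2 * l * S) (2 * l * C)"
  have det0: "det g0 = \<mu> * K"
  proof -
    have "det g0 = l^2 * (C^2 + S^2)"
      by (simp add: g0_def det_mat2 power2_eq_square algebra_simps)
    then show ?thesis
      by (simp add: K l)
  qed
  have row0: "(g0$1$1)^2 + (g0$1$2)^2 = \<mu> * K / 4"
  proof -
    have "(g0$1$1)^2 + (g0$1$2)^2 = l^2 * (C^2 + S^2) / 4"
      by (simp add: g0_def power_mult_distrib power_divide algebra_simps add_divide_distrib)
    then show ?thesis
      by (simp add: K l)
  qed
  have "p * (l * C / 2) + q * (- 2 * l * S) = l * K * x" "p * (l * S / 2) + q * (2 * l * C) = l * K * y"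
    unfolding C_def S_def K_def z1_def z2_def by (simp_all add: field_simps power2_eq_square)
  then have "M ** g0 = mat2 (l * K * x) (l * K * y) ((M ** g0)$2$1) ((M ** g0)$2$2)"
    unfolding pq g0_def mat2_mult by simp
  then have "ca (subst_form (M ** g0) v)
      = a * (l * K * x)^3 + b * (l * K * x)^2 * (l * K * y) + c * (l * K * x) * (l * K * y)^2 + d * (l * K * y)^3"
    by (metis vc subst_form_mat2 cubic_form.sel(1))
  also have "\<dots> = (l * K)^3 * (a * x^3 + b * x^2 * y + c * x * y^2 + d * y^3)"
    by algebra
  finally obtain b0 c0 d0 where h0: "subst_form (M ** g0) v = Cubic 0 b0 c0 d0"
    using xy by (metis cubic_form.collapse mult_zero_right)
  have detM': "det M' = 1"
    using M by (metis det_I det_mul mult.right_neutral)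
  have "disc (Cubic 0 b0 c0 d0) = det (M ** g0)^6 * disc v"
    unfolding h0[symmetric] by (rule disc_subst_form)
  then have "disc (Cubic 0 b0 c0 d0) \<noteq> 0"
    using \<mu> K v by (simp add: det_mul M det0)
  \<comment> \<open>With \<open>a = 0\<close> the discriminant is \<open>b^2 (c^2 - 4 b d)\<close>.
    That \<open>b0\<close> is nonzero later keeps the models apart.\<close>
  then have b0: "b0 \<noteq> 0"
    by (auto simp: disc_def)
  \<comment> \<open>The cone with strict inequalities, cut down to the discriminant window: an open
    set that contains \<open>g0\<close>.\<close>
  define V where "V = {g :: real^2^2. 0 < det g}
     \<inter> {g. 2 * \<bar>g$1$1 * g$2$1 + g$1$2 * g$2$2\<bar> < (g$1$1)^2 + (g$1$2)^2}
     \<inter> {g. (g$1$1)^2 + (g$1$2)^2 < det g}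
     \<inter> {g. lo < det g^6 * \<bar>disc v\<bar>} \<inter> {g. det g^6 * \<bar>disc v\<bar> < hi}"
  have "open V"
    unfolding V_def det_2 by (intro open_Int open_Collect_less continuous_intros)
  have "continuous_on UNIV (\<lambda>h :: real^2^2. M' ** h)"
  proof -
    obtain p' q' r' s' where M': "M' = mat2 p' q' r' s'" by (rule mat2_exhaust)
    have "M' ** h = mat2 (p' * h$1$1 + q' * h$2$1) (p' * h$1$2 + q' * h$2$2)
        (r' * h$1$1 + s' * h$2$1) (r' * h$1$2 + s' * h$2$2)" for h
      unfolding M' by (subst mat2_eta[symmetric], subst mat2_mult) simp
    then have eq: "(\<lambda>h. M' ** h) = (\<lambda>h. mat2 (p' * h$1$1 + q' * h$2$1) (p' * h$1$2 + q' * h$2$2)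
        (r' * h$1$1 + s' * h$2$1) (r' * h$1$2 + s' * h$2$2))"
      by blast
    show ?thesis
      by (subst eq) (intro continuous_intros)
  qed
  then have "open ((\<lambda>h. M' ** h) -` V)"
    using \<open>open V\<close> by (intro open_vimage)
  moreover have "g0 \<in> V"
  proof -
    have "g0$1$1 * g0$2$1 + g0$1$2 * g0$2$2 = 0"
      by (simp add: g0_def)
    then show ?thesis
      using \<mu> K by (simp add: V_def det0 row0 power_mult_distrib mult.assoc)
  qed
  then have "M ** g0 \<in> (\<lambda>h. M' ** h) -` V"
    by (simp add: matrix_mul_assoc M)
  moreover have "det (M ** g0) \<noteq> 0"
    using \<mu> K by (simp add: det_mul M det0)
  ultimately obtain \<epsilon> where \<epsilon>: "\<epsilon> > 0"
    "\<And>a b c d. \<lbrakk>\<bar>a - 0\<bar> < \<epsilon>; \<bar>b - b0\<bar> < \<epsilon>; \<bar>c - c0\<bar> < \<epsilon>; \<bar>d - d0\<bar> < \<epsilon>\<rbrakk>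
       \<Longrightarrow> \<exists>h\<in>(\<lambda>h. M' ** h) -` V. subst_form h v = Cubic a b c d"
    using open_orbit[OF v _ _ _ h0] by blast
  show ?thesis
  proof (rule that[OF \<epsilon>(1) b0])
    fix a b c d assume "\<bar>a\<bar> < \<epsilon>" "\<bar>b - b0\<bar> < \<epsilon>" "\<bar>c - c0\<bar> < \<epsilon>" "\<bar>d - d0\<bar> < \<epsilon>"
    then obtain h where h: "M' ** h \<in> V" "subst_form h v = Cubic a b c d"
      using \<epsilon>(2)[of a b c d] by auto
    have "\<bar>disc (Cubic a b c d)\<bar> = det h^6 * \<bar>disc v\<bar>"
      unfolding h(2)[symmetric] disc_subst_form by (simp add: abs_mult)
    moreover have "det h = det (M' ** h)"
      by (simp add: det_mul detM')
    moreover have "M' ** h \<in> siegel_cone"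
      using h(1) by (simp add: V_def siegel_cone_def)
    ultimately show "\<exists>g\<in>siegel_cone. subst_form M' (Cubic a b c d) = subst_form g v
         \<and> lo < \<bar>disc (Cubic a b c d)\<bar> \<and> \<bar>disc (Cubic a b c d)\<bar> < hi"
      using h by (intro bexI[of _ "M' ** h"]) (auto simp: V_def subst_form_mult[symmetric])
  qed
qed

section \<open>Irreducibility\<close>

text \<open>With \<open>a = 0\<close> the outer variable \<open>Y\<close> splits off, and neither
  factor is a unit. For integral forms \<open>|a| >= 1\<close> then bounds the height
  \<open>t\<close> from above.\<close>

lemma irreducible_lead_coeff_nonzero:
  assumes "irreducible_over_rat f"
  shows "ca f \<noteq> 0"
proof
  assume "ca f = 0"
  then have *: "form_poly (map_cubic_form rat_of_int f) =
      [:0, 1:] * [: monom (of_int (cb f)) 2, monom (of_int (cc f)) 1, monom (of_int (cd f)) 0 :]"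
    (is "_ = _ * ?q")
    by (simp add: form_poly_def cubic_form.map_sel)
  have "\<not> [:0, 1:] dvd (1 :: rat poly poly)"
    by (auto simp: is_unit_poly_iff)
  moreover have "\<not> ?q dvd 1"
  proof
    assume "?q dvd 1"
    then obtain c where c: "?q = [:c:]" "c dvd 1"
      by (auto simp: is_unit_poly_iff)
    then have "monom (of_int (cb f)) 2 dvd (1 :: rat poly)"
      by simp
    then obtain e where e: "monom (of_int (cb f)) 2 = [:e :: rat:]" "e dvd 1"
      unfolding is_unit_poly_iff by blast
    then have "coeff (monom (rat_of_int (cb f)) 2) 2 = coeff [:e:] 2" by simp
    then show False
      using e by (simp add: numeral_2_eq_2)
  qed
  ultimately show False
    using assms * unfolding irreducible_over_rat_def irreducible_def by blast
qed

lemma rat_poly_degree_one_root: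
  fixes p :: "rat poly"
  assumes "degree p = 1"
  obtains x where "poly p x = 0"
proof -
  have "coeff p 1 \<noteq> 0"
    using assms leading_coeff_0_iff[of p] by (metis degree_0 zero_neq_one)
  moreover have "p = [:coeff p 0, coeff p 1:]"
    using assms by (auto simp: poly_eq_iff coeff_pCons coeff_eq_0 split: nat.splits)
  ultimately have "poly p x = coeff p 0 + x * coeff p 1" for x
    by (metis add_0_right mult_zero_right poly_0 poly_pCons)
  then show ?thesis
    using \<open>coeff p 1 \<noteq> 0\<close> by (intro that[of "- coeff p 0 / coeff p 1"]) simp
qed

text \<open>Over \<open>\<rat>[X]\<close>, setting \<open>X = 1\<close> turns a nontrivial factorisation into one of a cubic polynomial
  over \<open>\<rat>\<close> with a linear factor.\<close>

lemma irreducible_over_rat_if_no_zero_mod_2: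
  assumes odd: "\<And>w. even (eval_form f w) \<Longrightarrow> even (w$1) \<and> even (w$2)"
  shows "irreducible_over_rat f"
proof -
  obtain a b c d where f: "f = Cubic a b c d" by (cases f)
  have no_zero: "even x \<and> even y" if "even (a * x^3 + b * x^2 * y + c * x * y^2 + d * y^3)" for x y
    using odd[of "vector [x, y]"] that by (simp add: f eval_form_def)
  have "a \<noteq> 0" "d \<noteq> 0"
    using no_zero[of 1 0] no_zero[of 0 1] by auto
  define F where "F = form_poly (map_cubic_form rat_of_int f)"
  have F: "F = [: monom (of_int a) 3, monom (of_int b) 2, monom (of_int c) 1, [:of_int d:] :]"
    by (simp add: F_def form_poly_def f monom_0)
  have degF: "degree F = 3"
    using \<open>d \<noteq> 0\<close> by (simp add: F)
  define h where "h = map_poly (\<lambda>p :: rat poly. poly p 1)"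
  have h_mult: "h (p * q) = h p * h q" for p q
    by (simp add: h_def poly_eq_iff coeff_map_poly coeff_mult poly_sum)
  have h_deg: "degree (h p) \<le> degree p" for p
    unfolding h_def by (rule degree_le) (simp add: coeff_map_poly coeff_eq_0)
  have hF: "h F = [:of_int a, of_int b, of_int c, of_int d:]"
    by (simp add: h_def F map_poly_pCons poly_monom)
  \<comment> \<open>A root \<open>m / n\<close> in lowest terms would be the zero
    \<open>(n, m)\<close> of the form, so both entries would be even.\<close>
  have noroot: "poly (h F) x \<noteq> 0" for x
  proof
    assume x: "poly (h F) x = 0"
    obtain m n where mn: "quotient_of x = (m, n)" by fastforce
    then have n: "n > 0" "coprime m n" and xq: "x = of_int m / of_int n"
      using quotient_of_denom_pos quotient_of_coprime quotient_of_div by blast+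
    have "of_int (a * n^3 + b * n^2 * m + c * n * m^2 + d * m^3) = poly (h F) x * of_int n^3"
      using n(1) by (simp add: hF xq field_simps power2_eq_square power3_eq_cube)
    then have "a * n^3 + b * n^2 * m + c * n * m^2 + d * m^3 = 0"
      using x by (metis mult_zero_left of_int_eq_0_iff)
    then have "even m" "even n"
      using no_zero[of n m] by auto
    then show False
      using n(2) by (meson coprime_common_divisor_int odd_one not_coprimeI)
  qed
  \<comment> \<open>A factor of degree 0 in \<open>Y\<close> divides the coefficient of
    \<open>Y^3\<close>, which is the nonzero constant \<open>d\<close>.\<close>
  have const: "p dvd 1" if "F = p * q" "degree p = 0" for p q
  proof -
    obtain p0 where p0: "p = [:p0:]"
      using \<open>degree p = 0\<close> by (metis degree_eq_zeroE)
    have "coeff F 3 = p0 * coeff q 3"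
      by (simp add: \<open>F = p * q\<close> p0)
    then have "p0 dvd [:of_int d:]"
      by (simp add: F numeral_3_eq_3)
    then have "p0 dvd 1"
      using \<open>d \<noteq> 0\<close> by (metis dvd_trans is_unit_const_poly_iff of_int_eq_0_iff dvd_field_iff one_neq_zero dvd_unit_imp_unit)
    then show ?thesis
      unfolding p0 by (metis is_unit_const_poly_iff)
  qed
  have linear: False if "F = p * q" "degree p = 1" for p q
  proof -
    have "p \<noteq> 0" "q \<noteq> 0" using that degF by auto
    then have "degree q = 2"
      using degF that by (simp add: degree_mult_eq)
    have hpq: "h F = h p * h q"
      unfolding \<open>F = p * q\<close> by (rule h_mult)
    then have "h p \<noteq> 0" "h q \<noteq> 0"
      using noroot[of 0] by auto
    then have "degree (h F) = degree (h p) + degree (h q)"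
      unfolding hpq by (rule degree_mult_eq)
    moreover have "degree (h F) = 3"
      using \<open>d \<noteq> 0\<close> by (simp add: hF)
    ultimately have "degree (h p) + degree (h q) = 3"
      by simp
    \<comment> \<open>\<open>h\<close> cannot raise degrees, and the total degree stays 3 because
      \<open>d\<close> does not involve \<open>X\<close>; so no degree drops in either
      factor.\<close>
    then have "degree (h p) = 1"
      using h_deg[of p] h_deg[of q] \<open>degree p = 1\<close> \<open>degree q = 2\<close> by linarith
    then obtain x where "poly (h p) x = 0"
      by (rule rat_poly_degree_one_root)
    then have "poly (h F) x = 0"
      by (simp add: hpq)
    then show False
      using noroot by blast
  qed
  have "irreducible F"
  proof (rule irreducibleI)
    show "F \<noteq> 0" "\<not> F dvd 1"
      using degF by (auto simp: is_unit_poly_iff)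
  next
    fix p q assume pq: "F = p * q"
    have "p \<noteq> 0" "q \<noteq> 0" using pq degF by auto
    then have "degree p + degree q = 3"
      using degF pq by (simp add: degree_mult_eq)
    moreover have "degree p \<noteq> 1" "degree q \<noteq> 1"
      using linear[of p q] linear[of q p] pq by (auto simp: mult.commute)
    ultimately have "degree p = 0 \<or> degree q = 0"
      by linarith
    then show "p dvd 1 \<or> q dvd 1"
      using const[of p q] const[of q p] pq by (auto simp: mult.commute)
  qed
  then show ?thesis
    by (simp add: irreducible_over_rat_def F_def)
qed

text \<open>Modulo 2 the form is \<open>X^3 + X Y^2 + Y^3\<close>, whose values at
  \<open>(1,0)\<close>, \<open>(0,1)\<close> and \<open>(1,1)\<close> are all 1. An invertible
  integral \<open>M\<close> permutes these three classes.\<close>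

lemma irreducible_subst_monic:
  assumes "even b" "odd c" "odd d" and M: "M ** M' = mat 1"
  shows "irreducible_over_rat (subst_form M (Cubic 1 b c d))"
proof (rule irreducible_over_rat_if_no_zero_mod_2)
  fix w assume "even (eval_form (subst_form M (Cubic 1 b c d)) w)"
  then have "even (eval_form (Cubic 1 b c d) (w v* M))"
    by (simp add: eval_subst_form)
  then have "even ((w v* M)$1)" "even ((w v* M)$2)"
    using assms(1-3) by (auto simp: eval_form_def)
  moreover have "w = (w v* M) v* M'"
    by (simp add: vector_matrix_mul_assoc M)
  ultimately show "even (w$1) \<and> even (w$2)"
    by (metis (no_types, lifting) dvd_add dvd_mult dvd_mult2 vector_matrix_mult_def sum_2 vec_lambda_beta)
qed

section \<open>Upper bounds\<close>

lemma disc_map_times: "disc (map_cubic_form ((*) x) f) = x^4 * disc (f :: 'a::idom cubic_form)"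
proof -
  obtain a b c d where f: "f = Cubic a b c d" by (cases f)
  show ?thesis
    unfolding disc_def f cubic_form.map cubic_form.sel by algebra
qed

lemma disc_real_form: "disc (real_form f) = of_int (disc f)"
  by (simp add: disc_def cubic_form.map_sel)

lemma disc_twisted_act:
  assumes "det g \<noteq> (0::'a::field)"
  shows "disc (twisted_act g f) = det g^2 * disc f"
proof -
  have "inverse (det g)^4 * (det g^6 * disc f) = (inverse (det g) * det g)^4 * (det g^2 * disc f)"
    by algebra
  then show ?thesis
    using assms by (simp add: twisted_act_def disc_map_times disc_subst_form)
qed

lemma SO2_entries:
  assumes "k \<in> SO2"
  shows "\<bar>k$i$j\<bar> \<le> 1"
proof -
  have "norm (row i k) = 1"
    using assms by (simp add: SO2_def orthogonal_matrix_orthonormal_rows)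
  then show ?thesis
    using component_le_norm_cart[of "row i k" j] by (simp add: row_def)
qed

text \<open>Entries of a rotation are at most 1 in absolute value, and in each new coefficient the
  weights attached to any one old coefficient add up to at most 3.\<close>

lemma subst_form_SO2_bound:
  assumes "k \<in> SO2" and v: "subst_form k (Cubic a b c d) = Cubic a1 b1 c1 d1"
  shows "\<bar>a1\<bar> \<le> 3 * (\<bar>a\<bar> + \<bar>b\<bar> + \<bar>c\<bar> + \<bar>d\<bar>)" "\<bar>b1\<bar> \<le> 3 * (\<bar>a\<bar> + \<bar>b\<bar> + \<bar>c\<bar> + \<bar>d\<bar>)"
    "\<bar>c1\<bar> \<le> 3 * (\<bar>a\<bar> + \<bar>b\<bar> + \<bar>c\<bar> + \<bar>d\<bar>)" "\<bar>d1\<bar> \<le> 3 * (\<bar>a\<bar> + \<bar>b\<bar> + \<bar>c\<bar> + \<bar>d\<bar>)"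
proof -
  obtain p q r s where k: "k = mat2 p q r s" by (rule mat2_exhaust)
  have k1: "\<bar>p\<bar> \<le> 1" "\<bar>q\<bar> \<le> 1" "\<bar>r\<bar> \<le> 1" "\<bar>s\<bar> \<le> 1"
    using SO2_entries[OF assms(1), of 1 1] SO2_entries[OF assms(1), of 1 2]
      SO2_entries[OF assms(1), of 2 1] SO2_entries[OF assms(1), of 2 2] by (simp_all add: k)
  have m: "\<bar>x * y * z\<bar> \<le> 1" if "\<bar>x\<bar> \<le> 1" "\<bar>y\<bar> \<le> 1" "\<bar>z\<bar> \<le> 1" for x y z :: real
    using that by (simp add: abs_mult mult_le_one)
  have m2: "\<bar>e * x\<bar> \<le> \<bar>e\<bar>" if "\<bar>x\<bar> \<le> 1" for e x :: real
    using that by (simp add: abs_mult mult_left_le)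
  have w: "Cubic a1 b1 c1 d1 = Cubic (a * (p * p * p) + b * (p * p * q) + c * (p * q * q) + d * (q * q * q))
      (3 * (a * (p * p * r)) + (b * (p * p * s) + 2 * (b * (p * q * r))) + (2 * (c * (p * q * s)) + c * (q * q * r))
         + 3 * (d * (q * q * s)))
      (3 * (a * (p * r * r)) + (2 * (b * (p * r * s)) + b * (q * r * r)) + (c * (p * s * s) + 2 * (c * (q * r * s)))
         + 3 * (d * (q * s * s)))
      (a * (r * r * r) + b * (r * r * s) + c * (r * s * s) + d * (s * s * s))"
    unfolding v[symmetric] k subst_form_mat2 by (simp add: power2_eq_square power3_eq_cube algebra_simps)
  have bU: "e * (x * y * z) \<le> \<bar>e\<bar>" and bL: "- (e * (x * y * z)) \<le> \<bar>e\<bar>"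
    if "\<bar>x\<bar> \<le> 1" "\<bar>y\<bar> \<le> 1" "\<bar>z\<bar> \<le> 1" for e x y z :: real
    using m2[OF m[OF that], of e] by (simp_all only: abs_le_iff)
  define A B C D where A_def: "A = \<bar>a\<bar>" and B_def: "B = \<bar>b\<bar>" and C_def: "C = \<bar>c\<bar>" and D_def: "D = \<bar>d\<bar>"
  have nn: "0 \<le> A" "0 \<le> B" "0 \<le> C" "0 \<le> D"
    by (simp_all add: A_def B_def C_def D_def)
  define S where "S = 3 * (\<bar>a\<bar> + \<bar>b\<bar> + \<bar>c\<bar> + \<bar>d\<bar>)"
  have "a1 = a * (p * p * p) + b * (p * p * q) + c * (p * q * q) + d * (q * q * q)"
    using w by simp
  then have "a1 \<le> S" "- a1 \<le> S"
    using bU[OF k1(1) k1(1) k1(1), of a] bU[OF k1(1) k1(1) k1(2), of b] bU[OF k1(1) k1(2) k1(2), of c] bU[OF k1(2) k1(2) k1(2), of d]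
      bL[OF k1(1) k1(1) k1(1), of a] bL[OF k1(1) k1(1) k1(2), of b] bL[OF k1(1) k1(2) k1(2), of c] bL[OF k1(2) k1(2) k1(2), of d] nn
    unfolding S_def A_def[symmetric] B_def[symmetric] C_def[symmetric] D_def[symmetric] distrib_left by - linarith+
  then show "\<bar>a1\<bar> \<le> 3 * (\<bar>a\<bar> + \<bar>b\<bar> + \<bar>c\<bar> + \<bar>d\<bar>)"
    unfolding S_def by (rule abs_leI)
  have "b1 = 3 * (a * (p * p * r)) + (b * (p * p * s) + 2 * (b * (p * q * r))) + (2 * (c * (p * q * s)) + c * (q * q * r)) + 3 * (d * (q * q * s))"
    using w by simp
  then have "b1 \<le> S" "- b1 \<le> S"
    using bU[OF k1(1) k1(1) k1(3), of a] bU[OF k1(1) k1(1) k1(4), of b] bU[OF k1(1) k1(2) k1(3), of b] bU[OF k1(1) k1(2) k1(4), of c] bU[OF k1(2) k1(2) k1(3), of c] bU[OF k1(2) k1(2) k1(4), of d]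
      bL[OF k1(1) k1(1) k1(3), of a] bL[OF k1(1) k1(1) k1(4), of b] bL[OF k1(1) k1(2) k1(3), of b] bL[OF k1(1) k1(2) k1(4), of c] bL[OF k1(2) k1(2) k1(3), of c] bL[OF k1(2) k1(2) k1(4), of d] nn
    unfolding S_def A_def[symmetric] B_def[symmetric] C_def[symmetric] D_def[symmetric] distrib_left by - linarith+
  then show "\<bar>b1\<bar> \<le> 3 * (\<bar>a\<bar> + \<bar>b\<bar> + \<bar>c\<bar> + \<bar>d\<bar>)"
    unfolding S_def by (rule abs_leI)
  have "c1 = 3 * (a * (p * r * r)) + (2 * (b * (p * r * s)) + b * (q * r * r)) + (c * (p * s * s) + 2 * (c * (q * r * s))) + 3 * (d * (q * s * s))"
    using w by simp
  then have "c1 \<le> S" "- c1 \<le> S"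
    using bU[OF k1(1) k1(3) k1(3), of a] bU[OF k1(1) k1(3) k1(4), of b] bU[OF k1(2) k1(3) k1(3), of b] bU[OF k1(1) k1(4) k1(4), of c] bU[OF k1(2) k1(3) k1(4), of c] bU[OF k1(2) k1(4) k1(4), of d]
      bL[OF k1(1) k1(3) k1(3), of a] bL[OF k1(1) k1(3) k1(4), of b] bL[OF k1(2) k1(3) k1(3), of b] bL[OF k1(1) k1(4) k1(4), of c] bL[OF k1(2) k1(3) k1(4), of c] bL[OF k1(2) k1(4) k1(4), of d] nn
    unfolding S_def A_def[symmetric] B_def[symmetric] C_def[symmetric] D_def[symmetric] distrib_left by - linarith+
  then show "\<bar>c1\<bar> \<le> 3 * (\<bar>a\<bar> + \<bar>b\<bar> + \<bar>c\<bar> + \<bar>d\<bar>)"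
    unfolding S_def by (rule abs_leI)
  have "d1 = a * (r * r * r) + b * (r * r * s) + c * (r * s * s) + d * (s * s * s)"
    using w by simp
  then have "d1 \<le> S" "- d1 \<le> S"
    using bU[OF k1(3) k1(3) k1(3), of a] bU[OF k1(3) k1(3) k1(4), of b] bU[OF k1(3) k1(4) k1(4), of c] bU[OF k1(4) k1(4) k1(4), of d]
      bL[OF k1(3) k1(3) k1(3), of a] bL[OF k1(3) k1(3) k1(4), of b] bL[OF k1(3) k1(4) k1(4), of c] bL[OF k1(4) k1(4) k1(4), of d] nn
    unfolding S_def A_def[symmetric] B_def[symmetric] C_def[symmetric] D_def[symmetric] distrib_left by - linarith+
  then show "\<bar>d1\<bar> \<le> 3 * (\<bar>a\<bar> + \<bar>b\<bar> + \<bar>c\<bar> + \<bar>d\<bar>)"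
    unfolding S_def by (rule abs_leI)
qed

text \<open>The rotation is absorbed into \<open>v\<close>. What remains is lower triangular with
  diagonal \<open>l / t\<close>, \<open>l * t\<close>, and the twist divides by \<open>l^2\<close>;
  the factor \<open>n(u)\<close> only adds multiples of earlier coefficients.\<close>

lemma fund_dom_coefficients:
  assumes "k \<in> SO2" "l > 0" "t > 0"
    and v: "subst_form k v = Cubic a1 b1 c1 d1"
  shows "twisted_act (n_mat u ** a_mat t ** k ** mat l) v =
    Cubic (l / t^3 * a1)
      (3 * u * (l / t^3 * a1) + l / t * b1)
      (3 * u^2 * (l / t^3 * a1) + 2 * u * (l / t * b1) + l * t * c1)
      (u^3 * (l / t^3 * a1) + u^2 * (l / t * b1) + u * (l * t * c1) + l * t^3 * d1)"
proof -
  obtain p q r s where k: "k = mat2 p q r s" by (rule mat2_exhaust)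
  have g: "n_mat u ** a_mat t ** k ** mat l = mat2 (l / t) 0 (u * (l / t)) (l * t) ** k"
    unfolding k n_mat_eq a_mat_eq mat_eq_mat2 mat2_mult
    by (simp add: mat2_def field_simps)
  have "det k = 1"
    using assms(1) by (simp add: SO2_def)
  then have "det (n_mat u ** a_mat t ** k ** mat l) = l^2"
    using assms unfolding g by (simp add: det_mul det_mat2 power2_eq_square)
  moreover have "subst_form (n_mat u ** a_mat t ** k ** mat l) v
      = subst_form (mat2 (l / t) 0 (u * (l / t)) (l * t)) (Cubic a1 b1 c1 d1)"
    unfolding g subst_form_mult[symmetric] v ..
  ultimately show ?thesis
    using assms by (simp add: twisted_act_def subst_form_mat2 field_simps power2_eq_square power3_eq_cube)
qed

text \<open>The discriminant is \<open>l^4\<close> times that of \<open>v\<close>, which bounds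
  \<open>l\<close> by a multiple of \<open>X powr (1/4)\<close>. Since \<open>t >= 1/2\<close>, each
  of the weights \<open>1, t^2, t^4, t^6\<close> is at most 4 times the next one, so the terms
  created by \<open>u\<close> are absorbed.\<close>

lemma fund_dom_coefficient_bounds:
  fixes v :: "real cubic_form"
  assumes v: "disc v \<noteq> 0" and "cp > 0"
  obtains K where "K > 0"
    "\<And>u t k l X a b c d. \<lbrakk>\<bar>u\<bar> \<le> 1/2; t \<ge> 1/2; k \<in> SO2; l > 0; X > 0;
       \<bar>disc (twisted_act (n_mat u ** a_mat t ** k ** mat l) v)\<bar> < cp * X;
       twisted_act (n_mat u ** a_mat t ** k ** mat l) v = Cubic a b c d\<rbrakk> \<Longrightarrow>
       \<bar>a\<bar> * t^3 \<le> K * X powr (1/4) \<and> \<bar>b\<bar> * t \<le> K * X powr (1/4)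
       \<and> \<bar>c\<bar> \<le> K * X powr (1/4) * t \<and> \<bar>d\<bar> \<le> K * X powr (1/4) * t^3"
proof -
  obtain va vb vc vd where vv: "v = Cubic va vb vc vd" by (cases v)
  define C where "C = 3 * (\<bar>va\<bar> + \<bar>vb\<bar> + \<bar>vc\<bar> + \<bar>vd\<bar>)"
  define L where "L = (cp / \<bar>disc v\<bar>) powr (1/4)"
  have "L > 0" using assms by (simp add: L_def)
  have "va \<noteq> 0 \<or> vb \<noteq> 0 \<or> vc \<noteq> 0 \<or> vd \<noteq> 0"
    using v by (auto simp: vv disc_def)
  then have "C > 0"
    unfolding C_def by (smt (verit))
  show ?thesis
  \<comment> \<open>The largest constant occurs for \<open>c\<close>, namely
    \<open>3 * 1/4 * 16 + 2 * 1/2 * 4 + 1 = 17\<close>.\<close>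
  proof (rule that[of "17 * C * L"])
    show "17 * C * L > 0" using \<open>L > 0\<close> \<open>C > 0\<close> by simp
  next
    fix u t l X a b c d :: real and k
    assume u: "\<bar>u\<bar> \<le> 1/2" and t: "t \<ge> 1/2" and k: "k \<in> SO2" and "l > 0" "X > 0"
      and disc: "\<bar>disc (twisted_act (n_mat u ** a_mat t ** k ** mat l) v)\<bar> < cp * X"
      and abcd: "twisted_act (n_mat u ** a_mat t ** k ** mat l) v = Cubic a b c d"
    obtain a1 b1 c1 d1 where kv: "subst_form k v = Cubic a1 b1 c1 d1" by (cases "subst_form k v")
    have *: "\<bar>a1\<bar> \<le> C" "\<bar>b1\<bar> \<le> C" "\<bar>c1\<bar> \<le> C" "\<bar>d1\<bar> \<le> C"
      using subst_form_SO2_bound[OF k kv[unfolded vv]] by (simp_all add: C_def)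
    have "t > 0" using t by simp
    have det: "det (n_mat u ** a_mat t ** k ** mat l) = l^2"
      using k \<open>t > 0\<close> by (simp add: det_mul SO2_def n_mat_eq a_mat_eq mat_eq_mat2 det_mat2 power2_eq_square)
    have "l^4 * \<bar>disc v\<bar> < cp * X"
      using disc \<open>l > 0\<close> by (simp add: disc_twisted_act det abs_mult)
    then have "l^4 \<le> cp / \<bar>disc v\<bar> * X"
      using v by (simp add: field_simps)
    then have "(l^4) powr (1/4) \<le> (cp / \<bar>disc v\<bar> * X) powr (1/4)"
      by (intro powr_mono2) auto
    moreover have "(l^4) powr (1/4) = l"
    proof -
      have "l^4 = l powr 4"
        using \<open>l > 0\<close> by simp
      then show ?thesis
        using \<open>l > 0\<close> by (simp only: powr_powr) simp
    qed
    moreover have "(cp / \<bar>disc v\<bar> * X) powr (1/4) = L * X powr (1/4)"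
      unfolding L_def by (rule powr_mult)
    ultimately have l: "l \<le> L * X powr (1/4)"
      by simp
    define Y where "Y = 17 * C * L * X powr (1/4)"
    have Y: "17 * (C * l) \<le> Y"
      using l \<open>C > 0\<close> by (simp add: Y_def mult.assoc)
    \<comment> \<open>In terms of \<open>x\<close> the four scales are \<open>x\<close>,
      \<open>x * t^2\<close>, \<open>x * t^4\<close>, \<open>x * t^6\<close>, so only even powers of
      \<open>t\<close> have to be compared.\<close>
    define x where "x = l / t^3"
    have lx: "l = x * t^3" "x > 0"
      using \<open>t > 0\<close> \<open>l > 0\<close> by (simp_all add: x_def)
    have x: "l / t = x * t^2" "l * t = x * t^4" "l * t^3 = x * t^6"
      using \<open>t > 0\<close> unfolding lx(1) by (simp_all add: eval_nat_numeral)
    note x = x lx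
    have t2: "1/4 \<le> t^2"
      using power_mono[OF t, of 2] by (simp add: power2_eq_square)
    have t4: "1/4 * t^2 \<le> t^4" "1/4 * t^4 \<le> t^6"
      using mult_right_mono[OF t2, of "t^2"] mult_right_mono[OF t2, of "t^4"]
      by (simp_all flip: power_add)
    have u2: "\<bar>u^2\<bar> \<le> 1/4" "\<bar>u^3\<bar> \<le> 1/8"
      using power_mono[OF u, of 2] power_mono[OF u, of 3] unfolding power_abs by (simp_all add: power_divide)
    have m: "\<bar>w * (y * z)\<bar> \<le> e * (y * C)" if "\<bar>w\<bar> \<le> e" "0 \<le> y" "\<bar>z\<bar> \<le> C" for w y z e
      using that unfolding abs_mult by (intro mult_mono) auto
    have C: "C * x * (1/4) \<le> C * x * t^2" "C * x * (1/4 * t^2) \<le> C * x * t^4" "C * x * (1/4 * t^4) \<le> C * x * t^6"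
      using t2 t4 \<open>C > 0\<close> x(5) by (intro mult_left_mono; simp)+
    have Cx: "0 \<le> C * x"
      using \<open>C > 0\<close> x(5) by simp
    have ab: "a = 1 * (x * a1)" "b = 3 * (u * (x * a1)) + 1 * (x * t^2 * b1)"
      "c = 3 * (u^2 * (x * a1)) + 2 * (u * (x * t^2 * b1)) + 1 * (x * t^4 * c1)"
      "d = u^3 * (x * a1) + u^2 * (x * t^2 * b1) + u * (x * t^4 * c1) + 1 * (x * t^6 * d1)"
      using abcd[symmetric] unfolding fund_dom_coefficients[OF k \<open>l > 0\<close> \<open>t > 0\<close> kv] x_def[symmetric] x(1-3)
      by (simp_all add: mult.assoc)
    have nn: "0 \<le> x" "0 \<le> x * t^2" "0 \<le> x * t^4" "0 \<le> x * t^6" using x(5) by simp_all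
    note ms = m[OF _ nn(1) *(1)] m[OF _ nn(2) *(2)] m[OF _ nn(3) *(3)] m[OF _ nn(4) *(4)]
    have a': "\<bar>a\<bar> \<le> C * x"
      using ms(1)[of 1 1] ab(1) by (simp add: mult.commute)
    have "\<bar>b\<bar> \<le> 3 * \<bar>u * (x * a1)\<bar> + \<bar>1 * (x * t^2 * b1)\<bar>"
      unfolding ab(2) by (rule order_trans[OF abs_triangle_ineq]) (simp add: abs_mult)
    then have b': "\<bar>b\<bar> \<le> 7 * (C * x * t^2)"
      using ms(1)[OF u] ms(2)[of 1 1] C(1) by (simp add: algebra_simps)
    have "\<bar>c\<bar> \<le> 3 * \<bar>u^2 * (x * a1)\<bar> + 2 * \<bar>u * (x * t^2 * b1)\<bar> + \<bar>1 * (x * t^4 * c1)\<bar>"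
      unfolding ab(3) by (intro order_trans[OF abs_triangle_ineq] add_mono) (simp_all add: abs_mult)
    then have c': "\<bar>c\<bar> \<le> 17 * (C * x * t^4)"
      using ms(1)[OF u2(1)] ms(2)[OF u] ms(3)[of 1 1] C(1,2) by (simp add: algebra_simps)
    define e1 where "e1 = \<bar>u^3 * (x * a1)\<bar>"
    define e2 where "e2 = \<bar>u^2 * (x * t^2 * b1)\<bar>"
    define e3 where "e3 = \<bar>u * (x * t^4 * c1)\<bar>"
    define e4 where "e4 = \<bar>1 * (x * t^6 * d1)\<bar>"
    have "\<bar>d\<bar> \<le> e1 + e2 + e3 + e4"
      unfolding ab(4) e1_def e2_def e3_def e4_def
      by (intro order_trans[OF abs_triangle_ineq] add_mono) (simp_all add: abs_mult)
    moreover have "e1 \<le> 1/8 * (C * x)" "e2 \<le> 1/4 * (C * x * t^2)" "e3 \<le> 1/2 * (C * x * t^4)"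
      "e4 \<le> C * x * t^6"
      using ms(1)[OF u2(2)] ms(2)[OF u2(1)] ms(3)[OF u] ms(4)[of 1 1]
      by (simp_all add: e1_def e2_def e3_def e4_def ac_simps)
    ultimately have d': "\<bar>d\<bar> \<le> 17 * (C * x * t^6)"
      using C by (simp add: algebra_simps)
    have Cl: "0 \<le> C * l" using Cx x(4) \<open>t > 0\<close> \<open>l > 0\<close> \<open>C > 0\<close> by simp
    have "\<bar>a\<bar> * t^3 \<le> C * x * t^3"
      using a' \<open>t > 0\<close> by (intro mult_right_mono) auto
    also have "\<dots> = C * l"
      by (simp add: x(4) mult.assoc)
    finally have 1: "\<bar>a\<bar> * t^3 \<le> Y"
      using Y Cl by linarith
    have "\<bar>b\<bar> * t \<le> 7 * (C * x * t^2) * t"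
      using b' \<open>t > 0\<close> by (intro mult_right_mono) auto
    also have "\<dots> = 7 * (C * l)"
      by (simp add: x(4) eval_nat_numeral)
    finally have 2: "\<bar>b\<bar> * t \<le> Y"
      using Y Cl by linarith
    have "\<bar>c\<bar> \<le> 17 * (C * l) * t"
      using c' by (simp add: x(4) eval_nat_numeral mult.assoc)
    also have "\<dots> \<le> Y * t"
      using Y \<open>t > 0\<close> by (intro mult_right_mono) auto
    finally have 3: "\<bar>c\<bar> \<le> Y * t" .
    have "\<bar>d\<bar> \<le> 17 * (C * l) * t^3"
      using d' by (simp add: x(4) eval_nat_numeral mult.assoc)
    also have "\<dots> \<le> Y * t^3"
      using Y \<open>t > 0\<close> by (intro mult_right_mono) auto
    finally have 4: "\<bar>d\<bar> \<le> Y * t^3" .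
    show "\<bar>a\<bar> * t^3 \<le> 17 * C * L * X powr (1/4) \<and> \<bar>b\<bar> * t \<le> 17 * C * L * X powr (1/4)
       \<and> \<bar>c\<bar> \<le> 17 * C * L * X powr (1/4) * t \<and> \<bar>d\<bar> \<le> 17 * C * L * X powr (1/4) * t^3"
      using 1 2 3 4 by (simp add: Y_def)
  qed
qed

text \<open>\<open>Z\<close> is meant as a constant times \<open>X powr (1/4)\<close> and
  \<open>t\<close> as the height in the fundamental domain.\<close>

definition coeff_bounds :: "real \<Rightarrow> real \<Rightarrow> int cubic_form \<Rightarrow> bool" where
  "coeff_bounds Z t f \<longleftrightarrow> \<bar>real_of_int (ca f)\<bar> * t^3 \<le> Z \<and> \<bar>real_of_int (cb f)\<bar> * t \<le> Z
     \<and> \<bar>real_of_int (cc f)\<bar> \<le> Z * t \<and> \<bar>real_of_int (cd f)\<bar> \<le> Z * t^3"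

text \<open>A single decomposition \<open>n(u) a(t) k l\<close> of a matrix carrying
  \<open>v\<close> to \<open>f\<close> yields everything: its height \<open>t\<close> bounds the
  coefficients and puts \<open>f\<close> into the cusp piece for every \<open>T < t\<close>. The
  constant \<open>K\<close> is chosen before \<open>X\<close>, \<open>T\<close> and
  \<open>P\<close>.\<close>

lemma forms_at_coeff_bounds:
  fixes v :: "real cubic_form"
  assumes v: "disc v \<noteq> 0" and "cp > 0"
  obtains K where "K > 0"
    "\<And>\<nu> i cm P X f. \<lbrakk>gauss_range \<nu>; X > 0; f \<in> forms_at (fund_dom \<nu>) i v cm cp P X\<rbrakk> \<Longrightarrow>
       \<exists>t\<ge>1/2. coeff_bounds (K * X powr (1/4)) t f
         \<and> (\<forall>T<t. f \<in> forms_at (fund_dom_cusp \<nu> T) i v cm cp P X)"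
    "\<And>\<nu> i cm P X T f. \<lbrakk>gauss_range \<nu>; X > 0; f \<in> forms_at (fund_dom_cusp \<nu> T) i v cm cp P X\<rbrakk> \<Longrightarrow>
       \<exists>t\<ge>1/2. t > T \<and> coeff_bounds (K * X powr (1/4)) t f"
proof -
  obtain K where K: "K > 0"
    "\<And>u t k l X a b c d. \<lbrakk>\<bar>u\<bar> \<le> 1/2; t \<ge> 1/2; k \<in> SO2; l > 0; X > 0;
       \<bar>disc (twisted_act (n_mat u ** a_mat t ** k ** mat l) v)\<bar> < cp * X;
       twisted_act (n_mat u ** a_mat t ** k ** mat l) v = Cubic a b c d\<rbrakk> \<Longrightarrow>
       \<bar>a\<bar> * t^3 \<le> K * X powr (1/4) \<and> \<bar>b\<bar> * t \<le> K * X powr (1/4)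
       \<and> \<bar>c\<bar> \<le> K * X powr (1/4) * t \<and> \<bar>d\<bar> \<le> K * X powr (1/4) * t^3"
    using fund_dom_coefficient_bounds[OF assms] by blast
  have bounds: "coeff_bounds (K * X powr (1/4)) t f" "t \<ge> 1/2"
    if "gauss_range \<nu>" "X > 0" "u \<in> \<nu> t" "t \<ge> t0" "k \<in> SO2" "l > 0"
      and f: "real_form f = twisted_act (n_mat u ** a_mat t ** k ** mat l) v"
      and disc: "\<bar>real_of_int (disc f)\<bar> < cp * X" for \<nu> X u t k l f
  proof -
    show "t \<ge> 1/2" using t0_bounds that by linarith
    have "u \<in> {-1/2..1/2}"
      using that(1,3,4) unfolding gauss_range_def by blast
    then have "\<bar>u\<bar> \<le> 1/2" by auto
    moreover obtain a b c d where abcd: "f = Cubic a b c d" by (cases f)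
    moreover have "\<bar>disc (real_form f)\<bar> < cp * X"
      using disc by (simp add: disc_real_form)
    ultimately show "coeff_bounds (K * X powr (1/4)) t f"
      using K(2)[of u t k l X a b c d, folded f] that \<open>t \<ge> 1/2\<close>
      by (simp add: coeff_bounds_def abcd)
  qed
  show ?thesis
  proof (rule that[OF K(1)])
    fix \<nu> i cm P X f assume A: "gauss_range \<nu>" "X > 0" "f \<in> forms_at (fund_dom \<nu>) i v cm cp P X"
    then obtain u t k l where *: "u \<in> \<nu> t" "t \<ge> t0" "k \<in> SO2" "l > 0"
      "real_form f = twisted_act (n_mat u ** a_mat t ** k ** mat l) v"
      unfolding forms_at_def fund_dom_def by auto
    have "f \<in> forms_at (fund_dom_cusp \<nu> T) i v cm cp P X" if "T < t" for T
      using A * that unfolding forms_at_def fund_dom_cusp_def by blast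
    moreover have "\<bar>real_of_int (disc f)\<bar> < cp * X"
      using A by (simp add: forms_at_def)
    ultimately show "\<exists>t\<ge>1/2. coeff_bounds (K * X powr (1/4)) t f
         \<and> (\<forall>T<t. f \<in> forms_at (fund_dom_cusp \<nu> T) i v cm cp P X)"
      using bounds[OF A(1,2) *] by blast
  next
    fix \<nu> i cm P X T f assume A: "gauss_range \<nu>" "X > 0" "f \<in> forms_at (fund_dom_cusp \<nu> T) i v cm cp P X"
    then obtain u t k l where *: "u \<in> \<nu> t" "t \<ge> t0" "k \<in> SO2" "l > 0"
      "real_form f = twisted_act (n_mat u ** a_mat t ** k ** mat l) v" and "t > T"
      unfolding forms_at_def fund_dom_cusp_def by auto
    moreover have "\<bar>real_of_int (disc f)\<bar> < cp * X"
      using A by (simp add: forms_at_def)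
    ultimately show "\<exists>t\<ge>1/2. t > T \<and> coeff_bounds (K * X powr (1/4)) t f"
      using bounds[OF A(1,2) *] by blast
  qed
qed

section \<open>Counting integral forms with bounded coefficients\<close>

lemma forms_at_cusp_subset: "forms_at (fund_dom_cusp \<nu> T) i v cm cp P X \<subseteq> forms_at (fund_dom \<nu>) i v cm cp P X"
  unfolding forms_at_def fund_dom_def fund_dom_cusp_def by blast

lemma forms_at_lead_coeff_nonzero: "f \<in> forms_at G i v cm cp P X \<Longrightarrow> ca f \<noteq> 0"
  by (auto simp: forms_at_def V_int_irr_def irreducible_lead_coeff_nonzero)

lemma card_forms_box:
  fixes A B C D :: "'a set"
  assumes "finite A" "finite B" "finite C" "finite D"
  shows "finite {f. ca f \<in> A \<and> cb f \<in> B \<and> cc f \<in> C \<and> cd f \<in> D}"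
    and "card {f. ca f \<in> A \<and> cb f \<in> B \<and> cc f \<in> C \<and> cd f \<in> D} = card A * card B * card C * card D"
proof -
  have eq: "{f. ca f \<in> A \<and> cb f \<in> B \<and> cc f \<in> C \<and> cd f \<in> D} = (\<lambda>(a, b, c, d). Cubic a b c d) ` (A \<times> B \<times> C \<times> D)"
  proof (intro set_eqI iffI)
    fix f assume "f \<in> {f. ca f \<in> A \<and> cb f \<in> B \<and> cc f \<in> C \<and> cd f \<in> D}"
    then show "f \<in> (\<lambda>(a, b, c, d). Cubic a b c d) ` (A \<times> B \<times> C \<times> D)"
      by (intro image_eqI[of _ _ "(ca f, cb f, cc f, cd f)"]) auto
  qed auto
  show "finite {f. ca f \<in> A \<and> cb f \<in> B \<and> cc f \<in> C \<and> cd f \<in> D}"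
    unfolding eq using assms by simp
  show "card {f. ca f \<in> A \<and> cb f \<in> B \<and> cc f \<in> C \<and> cd f \<in> D} = card A * card B * card C * card D"
    unfolding eq by (subst card_image) (auto simp: inj_on_def card_cartesian_product)
qed

lemma card_int_abs_le:
  fixes M :: real
  shows "finite {n::int. \<bar>real_of_int n\<bar> \<le> M}"
    and "0 \<le> M \<Longrightarrow> real (card {n::int. \<bar>real_of_int n\<bar> \<le> M}) \<le> 2 * M + 1"
proof -
  have eq: "{n::int. \<bar>real_of_int n\<bar> \<le> M} = {-\<lfloor>M\<rfloor>..\<lfloor>M\<rfloor>}"
    by (auto simp: abs_le_iff le_floor_iff minus_le_iff)
  show "finite {n::int. \<bar>real_of_int n\<bar> \<le> M}"
    unfolding eq by simp
  show "real (card {n::int. \<bar>real_of_int n\<bar> \<le> M}) \<le> 2 * M + 1" if "0 \<le> M"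
  proof -
    have "real (card {-\<lfloor>M\<rfloor>..\<lfloor>M\<rfloor>}) = 2 * real_of_int \<lfloor>M\<rfloor> + 1"
      using that by simp
    then show ?thesis
      unfolding eq by linarith
  qed
qed

text \<open>A nonzero integer \<open>ca f\<close> gives \<open>t^3 <= Z\<close>, so the height, and
  with it every coefficient, is bounded.\<close>

lemma finite_coeff_bounds:
  assumes "Z \<ge> 0"
  shows "finite {f. ca f \<noteq> 0 \<and> (\<exists>t\<ge>1/2. coeff_bounds Z t f)}"
proof -
  \<comment> \<open>The sum dominates the separate bounds \<open>8 Z\<close>, \<open>2 Z\<close>,
    \<open>4 Z^2\<close>, \<open>Z^2\<close> for the four coefficients.\<close>
  define M where "M = 8 * Z + 4 * Z^2 + Z^2"
  define I where "I = {n::int. \<bar>real_of_int n\<bar> \<le> M}"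
  have "{f. ca f \<noteq> 0 \<and> (\<exists>t\<ge>1/2. coeff_bounds Z t f)} \<subseteq> {f. ca f \<in> I \<and> cb f \<in> I \<and> cc f \<in> I \<and> cd f \<in> I}"
  proof (safe)
    fix f :: "int cubic_form" and t :: real
    assume "ca f \<noteq> 0" and t: "t \<ge> 1/2" and "coeff_bounds Z t f"
    then have a: "\<bar>real_of_int (ca f)\<bar> * t^3 \<le> Z" and b: "\<bar>real_of_int (cb f)\<bar> * t \<le> Z"
     and c: "\<bar>real_of_int (cc f)\<bar> \<le> Z * t" and d: "\<bar>real_of_int (cd f)\<bar> \<le> Z * t^3"
      by (auto simp: coeff_bounds_def)
    have a1: "1 \<le> \<bar>real_of_int (ca f)\<bar>"
      using \<open>ca f \<noteq> 0\<close> by linarith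
    have "t > 0" using t by simp
    have "1 * t^3 \<le> \<bar>real_of_int (ca f)\<bar> * t^3"
      using a1 \<open>t > 0\<close> by (intro mult_right_mono) auto
    then have t3: "t^3 \<le> Z"
      using a by linarith
    have t2: "1/4 \<le> t^2" "1/8 \<le> t^3"
      using power_mono[OF t, of 2] power_mono[OF t, of 3] by (simp_all add: power_divide)
    have "1/4 * t \<le> t^2 * t"
      using t2 \<open>t > 0\<close> by (intro mult_right_mono) auto
    then have t1: "t \<le> 4 * Z"
      using t3 by (simp add: eval_nat_numeral)
    have Z2: "0 \<le> Z^2" by simp
    have "\<bar>real_of_int (ca f)\<bar> * (1/8) \<le> \<bar>real_of_int (ca f)\<bar> * t^3"
      using t2 by (intro mult_left_mono) auto
    then show "ca f \<in> I"
      using a Z2 assms unfolding I_def M_def mem_Collect_eq power2_eq_square by linarith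
    have "\<bar>real_of_int (cb f)\<bar> * (1/2) \<le> \<bar>real_of_int (cb f)\<bar> * t"
      using t by (intro mult_left_mono) auto
    then show "cb f \<in> I"
      using b Z2 assms unfolding I_def M_def mem_Collect_eq power2_eq_square by linarith
    have "Z * t \<le> 4 * (Z * Z)"
      using mult_left_mono[OF t1 assms] by simp
    then show "cc f \<in> I"
      using c Z2 assms unfolding I_def M_def mem_Collect_eq power2_eq_square by linarith
    have "Z * t^3 \<le> Z * Z"
      using t3 assms by (intro mult_left_mono) auto
    then show "cd f \<in> I"
      using d Z2 assms unfolding I_def M_def mem_Collect_eq power2_eq_square by linarith
  qed
  moreover have "finite {f. ca f \<in> I \<and> cb f \<in> I \<and> cc f \<in> I \<and> cd f \<in> I}"
    unfolding I_def by (intro card_forms_box card_int_abs_le)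
  ultimately show ?thesis
    by (rule finite_subset)
qed

text \<open>As \<open>card\<close> is 0 on infinite sets, the counts can be compared by inclusion
  only once finiteness is known.\<close>

lemma finite_forms_at:
  assumes "disc v \<noteq> 0" "cp > 0" "gauss_range \<nu>" "X > 0"
  shows "finite (forms_at (fund_dom \<nu>) i v cm cp P X)"
proof -
  obtain K where K: "K > 0"
    "\<And>\<nu> i cm P X f. \<lbrakk>gauss_range \<nu>; X > 0; f \<in> forms_at (fund_dom \<nu>) i v cm cp P X\<rbrakk> \<Longrightarrow>
       \<exists>t\<ge>1/2. coeff_bounds (K * X powr (1/4)) t f
         \<and> (\<forall>T<t. f \<in> forms_at (fund_dom_cusp \<nu> T) i v cm cp P X)"
    by (rule forms_at_coeff_bounds[OF assms(1,2)]) (rule that; assumption)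
  have "forms_at (fund_dom \<nu>) i v cm cp P X \<subseteq> {f. ca f \<noteq> 0 \<and> (\<exists>t\<ge>1/2. coeff_bounds (K * X powr (1/4)) t f)}"
    using K(2)[OF assms(3,4)] forms_at_lead_coeff_nonzero by blast
  then show ?thesis
    using finite_coeff_bounds K(1) by (meson finite_subset mult_nonneg_nonneg less_imp_le powr_ge_zero)
qed

text \<open>With the leading coefficient fixed and the height between \<open>1/2\<close> and
  \<open>T\<close>, three coefficients remain free, each of size \<open>O(Z)\<close> for fixed
  \<open>T\<close>.\<close>

lemma card_main_body_le:
  assumes "Z \<ge> 0" "T \<ge> 1"
  shows "real (card {f. ca f = e \<and> (\<exists>t. 1/2 \<le> t \<and> t \<le> T \<and> coeff_bounds Z t f)}) \<le> (4 * Z * T^3 + 1)^3"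
    (is "real (card ?S) \<le> _")
    and "finite {f. ca f = e \<and> (\<exists>t. 1/2 \<le> t \<and> t \<le> T \<and> coeff_bounds Z t f)}"
proof -
  \<comment> \<open>The factor 2 accounts for \<open>t >= 1/2\<close> in the bound on
    \<open>cb f\<close>.\<close>
  define I where "I = {n::int. \<bar>real_of_int n\<bar> \<le> 2 * Z * T^3}"
  have I: "finite I" "real (card I) \<le> 2 * (2 * Z * T^3) + 1"
    using card_int_abs_le[of "2 * Z * T^3"] assms by (simp_all add: I_def)
  have sub: "?S \<subseteq> {f. ca f \<in> {e} \<and> cb f \<in> I \<and> cc f \<in> I \<and> cd f \<in> I}"
  proof (safe)
    fix f :: "int cubic_form" and t :: real
    assume t: "1/2 \<le> t" "t \<le> T" and "coeff_bounds Z t f"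
    then have b: "\<bar>real_of_int (cb f)\<bar> * t \<le> Z"
     and c: "\<bar>real_of_int (cc f)\<bar> \<le> Z * t" and d: "\<bar>real_of_int (cd f)\<bar> \<le> Z * t^3"
      by (auto simp: coeff_bounds_def)
    have T: "1 \<le> T^3" "T \<le> T^3" "t^3 \<le> T^3"
      using assms(2) t by (simp_all add: power_mono self_le_power one_le_power)
    have *: "Z * 1 \<le> Z * T^3" "Z * t \<le> Z * T^3" "Z * t^3 \<le> Z * T^3"
      using assms T t by (intro mult_left_mono; linarith)+
    have "\<bar>real_of_int (cb f)\<bar> * (1/2) \<le> \<bar>real_of_int (cb f)\<bar> * t"
      using t by (intro mult_left_mono) auto
    then show "cb f \<in> I"
      using b * assms(1) unfolding I_def mem_Collect_eq by linarith
    show "cc f \<in> I" "cd f \<in> I"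
      using c d * assms(1) unfolding I_def mem_Collect_eq by - linarith+
  qed
  have fin: "finite {f. ca f \<in> {e} \<and> cb f \<in> I \<and> cc f \<in> I \<and> cd f \<in> I}"
    using I by (intro card_forms_box) auto
  then show "finite ?S"
    using sub finite_subset by blast
  have "card ?S \<le> card {e} * card I * card I * card I"
    using card_mono[OF fin sub] card_forms_box(2)[of "{e}" I I I] I by simp
  then have "real (card ?S) \<le> real (card I)^3"
    unfolding power3_eq_cube of_nat_mult[symmetric] of_nat_le_iff by simp
  also have "\<dots> \<le> (4 * Z * T^3 + 1)^3"
    using I by (intro power_mono) auto
  finally show "real (card ?S) \<le> (4 * Z * T^3 + 1)^3" .
qed

text \<open>Telescoping of \<open>1 / sqrt n <= 2 (sqrt n - sqrt (n - 1))\<close>.\<close>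

lemma sum_inverse_sqrt_le: "(\<Sum>n=1..N. 1 / sqrt (real n)) \<le> 2 * sqrt (real N)"
proof (induction N)
  case (Suc N)
  define x y where "x = sqrt (real N)" and "y = sqrt (real (Suc N))"
  have xy: "0 \<le> x" "x \<le> y" "0 < y" "y^2 - x^2 = 1"
    by (simp_all add: x_def y_def)
  have "1 = (y - x) * (y + x)"
    using xy(4) by (simp add: power2_eq_square algebra_simps)
  also have "\<dots> \<le> (y - x) * (2 * y)"
    using xy by (intro mult_left_mono) auto
  finally have "1 / y \<le> 2 * (y - x)"
    using xy by (simp add: field_simps)
  then show ?case
    using Suc by (simp add: x_def y_def)
qed simp

lemma sum_inverse_sqrt_abs_le:
  assumes "M \<ge> 0"
  shows "(\<Sum>a | a \<noteq> 0 \<and> \<bar>real_of_int a\<bar> \<le> M. 1 / sqrt \<bar>real_of_int a\<bar>) \<le> 4 * sqrt M"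
proof -
  define N where "N = nat \<lfloor>M\<rfloor>"
  have "real N \<le> M" using assms by (simp add: N_def)
  define h where "h a = 1 / sqrt \<bar>real_of_int a\<bar>" for a
  have sub: "{a. a \<noteq> 0 \<and> \<bar>real_of_int a\<bar> \<le> M} \<subseteq> int ` {1..N} \<union> (\<lambda>n. - int n) ` {1..N}"
  proof
    fix a :: int assume a: "a \<in> {a. a \<noteq> 0 \<and> \<bar>real_of_int a\<bar> \<le> M}"
    then have "\<bar>a\<bar> \<le> \<lfloor>M\<rfloor>" by (simp add: le_floor_iff)
    then have "nat \<bar>a\<bar> \<in> {1..N}" using a by (auto simp: N_def)
    moreover have "a = int (nat \<bar>a\<bar>) \<or> a = - int (nat \<bar>a\<bar>)" by auto
    ultimately show "a \<in> int ` {1..N} \<union> (\<lambda>n. - int n) ` {1..N}" by blast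
  qed
  have "(\<Sum>a | a \<noteq> 0 \<and> \<bar>real_of_int a\<bar> \<le> M. h a) \<le> sum h (int ` {1..N} \<union> (\<lambda>n. - int n) ` {1..N})"
    by (intro sum_mono2 sub) (auto simp: h_def)
  also have "\<dots> \<le> sum h (int ` {1..N}) + sum h ((\<lambda>n. - int n) ` {1..N})"
  proof -
    have "0 \<le> sum h (int ` {1..N} \<inter> (\<lambda>n. - int n) ` {1..N})"
      by (intro sum_nonneg) (auto simp: h_def)
    then show ?thesis
      using sum.union_inter[of "int ` {1..N}" "(\<lambda>n. - int n) ` {1..N}" h] by simp
  qed
  also have "\<dots> = 2 * (\<Sum>n=1..N. 1 / sqrt (real n))"
    by (subst (1 2) sum.reindex) (auto simp: inj_on_def h_def)
  also have "\<dots> \<le> 2 * (2 * sqrt (real N))"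
    using sum_inverse_sqrt_le by (intro mult_left_mono) auto
  also have "\<dots> \<le> 4 * sqrt M"
    using \<open>real N \<le> M\<close> by simp
  finally show ?thesis by (simp add: h_def)
qed

text \<open>The equation \<open>f(P) = 1\<close> determines the last coefficient; since \<open>t\<^sup>3 \<le> Z / \<bar>a\<bar>\<close>, the range of the
  third coefficient is controlled by the first one.\<close>

lemma card_cusp_le:
  fixes P :: "int^2"
  assumes P: "P $ 2 \<noteq> 0" and "T \<ge> 1" "Z > 0"
  shows "real (card {f. eval_form f P = 1 \<and> ca f \<noteq> 0 \<and> (\<exists>t>T. coeff_bounds Z t f)}) \<le> 36 * Z^3 / T"
    (is "real (card ?S) \<le> _")
proof (cases "Z \<ge> T")
  case False
  \<comment> \<open>Here \<open>t <= t^3 <= Z < T\<close>, against \<open>t > T\<close>.\<close>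
  have empty: "?S = {}"
  proof safe
    fix f :: "int cubic_form" and t assume "ca f \<noteq> 0" "t > T" "coeff_bounds Z t f"
    then have "1 * t^3 \<le> \<bar>real_of_int (ca f)\<bar> * t^3" "\<bar>real_of_int (ca f)\<bar> * t^3 \<le> Z"
      using assms by (auto simp: coeff_bounds_def intro!: mult_right_mono)
    moreover have "t \<le> t^3"
      using \<open>t > T\<close> assms by (intro self_le_power) auto
    ultimately show "f \<in> {}"
      using False \<open>t > T\<close> by linarith
  qed
  show ?thesis
    unfolding empty using assms by simp
next
  case True
  \<comment> \<open>\<open>M\<close> bounds both \<open>a\<close> and \<open>b\<close>, since
    \<open>T < t <= t^3\<close>.\<close>
  define M where "M = Z / T"
  have M: "M \<ge> 1" "M \<le> Z" "M > 0"
    using True assms by (simp_all add: M_def field_simps)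
  define A where "A = {a::int. a \<noteq> 0 \<and> \<bar>real_of_int a\<bar> \<le> M}"
  define B where "B = {b::int. \<bar>real_of_int b\<bar> \<le> M}"
  \<comment> \<open>From \<open>t^2 <= t^3 <= Z / |a|\<close> the bound \<open>Z t\<close> on the
    third coefficient becomes \<open>R a\<close>.\<close>
  define R where "R a = Z * sqrt (Z / \<bar>real_of_int a\<bar>)" for a
  define C where "C a = {c::int. \<bar>real_of_int c\<bar> \<le> R a}" for a
  have finA: "finite A"
    unfolding A_def by (rule finite_subset[OF _ card_int_abs_le(1)[of M]]) auto
  have finB: "finite B" and finC: "finite (C a)" for a
    unfolding B_def C_def by (rule card_int_abs_le)+
  define \<phi> where "\<phi> f = (ca f, cb f, cc f)" for f :: "int cubic_form"
  have inj: "inj_on \<phi> ?S"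
  proof (rule inj_onI)
    fix f g assume "f \<in> ?S" "g \<in> ?S" "\<phi> f = \<phi> g"
    then have *: "eval_form f P = eval_form g P" "ca f = ca g" "cb f = cb g" "cc f = cc g"
      by (auto simp: \<phi>_def)
    then have "cd f = cd g"
      using P by (simp add: eval_form_def)
    with * show "f = g"
      by (simp add: cubic_form.expand)
  qed
  have sub: "\<phi> ` ?S \<subseteq> (SIGMA a:A. B \<times> C a)"
  proof (rule image_subsetI)
    fix f assume "f \<in> ?S"
    then obtain t where "ca f \<noteq> 0" "t > T" "coeff_bounds Z t f" by blast
    then have a: "\<bar>real_of_int (ca f)\<bar> * t^3 \<le> Z" and b: "\<bar>real_of_int (cb f)\<bar> * t \<le> Z"
     and c: "\<bar>real_of_int (cc f)\<bar> \<le> Z * t" and t: "t \<ge> 1" "t > 0"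
      using assms by (auto simp: coeff_bounds_def)
    have "\<bar>real_of_int (ca f)\<bar> * T \<le> \<bar>real_of_int (ca f)\<bar> * t^3"
      using \<open>t > T\<close> t self_le_power[of t 3] by (intro mult_left_mono) auto
    then have "\<bar>real_of_int (ca f)\<bar> \<le> M"
      using a assms by (simp add: M_def field_simps)
    moreover have "\<bar>real_of_int (cb f)\<bar> * T \<le> \<bar>real_of_int (cb f)\<bar> * t"
      using \<open>t > T\<close> by (intro mult_left_mono) auto
    then have "\<bar>real_of_int (cb f)\<bar> \<le> M"
      using b assms by (simp add: M_def field_simps)
    moreover have "t^2 \<le> t^3"
      using t by (intro power_increasing) auto
    then have "t^2 \<le> Z / \<bar>real_of_int (ca f)\<bar>"
      using a \<open>ca f \<noteq> 0\<close> by (simp add: field_simps) (smt (verit) mult_left_mono)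
    then have "t \<le> sqrt (Z / \<bar>real_of_int (ca f)\<bar>)"
      by (rule real_le_rsqrt)
    then have "\<bar>real_of_int (cc f)\<bar> \<le> R (ca f)"
      using c assms unfolding R_def by (smt (verit) mult_left_mono)
    ultimately show "\<phi> f \<in> (SIGMA a:A. B \<times> C a)"
      using \<open>ca f \<noteq> 0\<close> by (simp add: \<phi>_def A_def B_def C_def)
  qed
  have "finite (SIGMA a:A. B \<times> C a)"
    using finA finB finC by auto
  then have "real (card ?S) \<le> real (card (SIGMA a:A. B \<times> C a))"
    unfolding of_nat_le_iff by (rule card_inj_on_le[OF inj sub])
  also have "\<dots> = (\<Sum>a\<in>A. real (card B) * real (card (C a)))"
    using finA finB finC by (simp add: card_cartesian_product)
  \<comment> \<open>Both \<open>M\<close> and \<open>R a\<close> are at least 1, so each count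
    \<open>2 x + 1\<close> is at most \<open>3 x\<close>.\<close>
  also have "\<dots> \<le> (\<Sum>a\<in>A. (3 * M) * (3 * R a))"
  proof (rule sum_mono)
    fix a assume "a \<in> A"
    then have "1 \<le> Z / \<bar>real_of_int a\<bar>"
      using M by (auto simp: A_def)
    then have "Z * 1 \<le> R a"
      unfolding R_def using assms by (intro mult_left_mono) auto
    then have R: "1 \<le> R a"
      using M by linarith
    have "real (card B) \<le> 3 * M"
      using card_int_abs_le(2)[of M] M unfolding B_def by linarith
    moreover have "real (card (C a)) \<le> 3 * R a"
      using card_int_abs_le(2)[of "R a"] R unfolding C_def by linarith
    ultimately show "real (card B) * real (card (C a)) \<le> (3 * M) * (3 * R a)"
      using M by (intro mult_mono) auto
  qed
  also have "\<dots> = 9 * M * Z * sqrt Z * (\<Sum>a\<in>A. 1 / sqrt \<bar>real_of_int a\<bar>)"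
    by (simp add: sum_distrib_left R_def real_sqrt_divide field_simps)
  also have "\<dots> \<le> 9 * M * Z * sqrt Z * (4 * sqrt M)"
    unfolding A_def using M assms by (intro mult_left_mono sum_inverse_sqrt_abs_le) auto
  \<comment> \<open>The saving \<open>1 / T\<close> sits in the remaining factor
    \<open>M = Z / T\<close>, so \<open>sqrt M\<close> may be replaced by
    \<open>sqrt Z\<close>.\<close>
  also have "\<dots> \<le> 9 * M * Z * sqrt Z * (4 * sqrt Z)"
    using M assms by (intro mult_left_mono) auto
  also have "\<dots> = 36 * Z^3 / T"
    using assms by (simp add: M_def power3_eq_cube)
  finally show ?thesis .
qed

section \<open>Lower bounds\<close>

text \<open>Integers of fixed parity have spacing 2, so an open interval of length
  \<open>2 r\<close> holds at least \<open>r - 1\<close> of them; \<open>r >= 2\<close> turns this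
  into \<open>r / 2\<close>.\<close>

lemma card_int_parity_ge:
  fixes x r :: real
  assumes "r \<ge> 2"
  shows "finite {n::int. \<bar>real_of_int n - x\<bar> < r \<and> even n = e}"
    and "r / 2 \<le> real (card {n::int. \<bar>real_of_int n - x\<bar> < r \<and> even n = e})"
proof -
  define I where "I = {n::int. \<bar>real_of_int n - x\<bar> < r \<and> even n = e}"
  have "I \<subseteq> {\<lfloor>x - r\<rfloor>..\<lceil>x + r\<rceil>}"
    by (auto simp: I_def abs_less_iff) linarith+
  then show fin: "finite {n::int. \<bar>real_of_int n - x\<bar> < r \<and> even n = e}"
    unfolding I_def[symmetric] by (rule finite_subset) simp
  define \<epsilon> :: int where "\<epsilon> = (if e then 0 else 1)"
  define lo where "lo = (x - of_int \<epsilon> - r) / 2"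
  have "(\<lambda>m. 2 * m + \<epsilon>) ` {\<lfloor>lo\<rfloor> + 1..\<lceil>lo + r\<rceil> - 1} \<subseteq> I"
  proof (rule image_subsetI)
    fix m assume "m \<in> {\<lfloor>lo\<rfloor> + 1..\<lceil>lo + r\<rceil> - 1}"
    then have "lo < of_int m" "of_int m < lo + r"
      by (simp_all, linarith+)
    then have "\<bar>real_of_int (2 * m + \<epsilon>) - x\<bar> < r"
      by (simp add: lo_def abs_less_iff field_simps)
    then show "2 * m + \<epsilon> \<in> I"
      by (simp add: I_def \<epsilon>_def)
  qed
  moreover have "inj_on (\<lambda>m. 2 * m + \<epsilon>) {\<lfloor>lo\<rfloor> + 1..\<lceil>lo + r\<rceil> - 1}"
    by (simp add: inj_on_def)
  ultimately have "card {\<lfloor>lo\<rfloor> + 1..\<lceil>lo + r\<rceil> - 1} \<le> card I"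
    using fin card_inj_on_le unfolding I_def by blast
  moreover have "r - 1 \<le> real (card {\<lfloor>lo\<rfloor> + 1..\<lceil>lo + r\<rceil> - 1})"
    by simp linarith
  ultimately show "r / 2 \<le> real (card {n::int. \<bar>real_of_int n - x\<bar> < r \<and> even n = e})"
    using assms unfolding I_def by linarith
qed

lemma eventually_ge_powr_at_top:
  fixes S a :: real
  assumes "a > 0"
  shows "\<forall>\<^sub>F X in at_top. S \<le> X powr a"
  using eventually_ge_at_top[of "max 1 S powr (1 / a)"]
proof eventually_elim
  case (elim X)
  then have "(max 1 S powr (1 / a)) powr a \<le> X powr a"
    using assms by (intro powr_mono2) auto
  then show ?case
    using assms by (simp add: powr_powr)
qed

section \<open>Monic forms and their models\<close>

lemma subst_form_translation:
  "subst_form (mat2 1 0 k 1) (Cubic 1 b c d) =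
     Cubic 1 (b + 3 * k) (3 * k^2 + 2 * b * k + c) (k^3 + b * k^2 + c * k + (d :: 'a::comm_ring_1))"
  by (simp add: subst_form_mat2 algebra_simps)

lemma subst_form_one: "subst_form (mat 1) f = (f :: 'a::comm_ring_1 cubic_form)"
  by (cases f) (simp add: mat_eq_mat2 subst_form_mat2)

lemma real_form_subst_mat2:
  "real_form (subst_form (mat2 p q r s) (Cubic a b c d)) =
     subst_form (mat2 (of_int p) (of_int q) (of_int r) (of_int s)) (Cubic (of_int a) (of_int b) (of_int c) (of_int d))"
  by (simp add: subst_form_mat2)

text \<open>\<open>p, q, r, s\<close> are the entries of the matrix that \<open>SOME\<close> picks
  in \<open>model\<close>. Applying its inverse to a monic form is therefore undone exactly by
  \<open>model\<close>, and only the reduction of \<open>b\<close> modulo 3 remains. Bezout provides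
  such a matrix.\<close>

lemma monic_model:
  fixes P :: "int^2"
  assumes "primitive P"
  obtains p q r s where "p * s - q * r = 1" "P $ 1 = p" "P $ 2 = q"
    "\<And>b c d. eval_form (subst_form (mat2 s (-q) (-r) p) (Cubic 1 b c d)) P = 1"
    "\<And>b c d. model (subst_form (mat2 s (-q) (-r) p) (Cubic 1 b c d)) P =
       (let k = (b mod 3 - b) div 3 in (b mod 3, 3 * k^2 + 2 * b * k + c, k^3 + b * k^2 + c * k + d))"
proof -
  define M :: "int^2^2" where "M = (SOME M :: int^2^2. det M = 1 \<and> row 1 M = P)"
  have "\<exists>M :: int^2^2. det M = 1 \<and> row 1 M = P"
  proof -
    have "gcd (P$1) (P$2) = 1"
      using assms by (simp add: primitive_def coprime_iff_gcd_eq_1)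
    then obtain x y where "x * P$1 + y * P$2 = 1"
      using bezout_int[of "P$1" "P$2"] by auto
    then have "det (mat2 (P$1) (P$2) (-y) x) = 1" "row 1 (mat2 (P$1) (P$2) (-y) x) = P"
      by (simp_all add: det_mat2 row_def vec_eq_iff forall_2 algebra_simps)
    then show ?thesis by blast
  qed
  then have M: "det M = 1" "row 1 M = P"
    unfolding M_def by (metis (mono_tags, lifting) someI_ex)+
  obtain p q r s where pq: "M = mat2 p q r s" by (rule mat2_exhaust)
  have 1: "p * s - q * r = 1" "P $ 1 = p" "P $ 2 = q"
    using M by (auto simp: pq det_mat2 row_def)
  have inv: "mat2 p q r s ** mat2 s (-q) (-r) p = mat 1"
    using 1 by (simp add: mat2_mult mat_eq_mat2 algebra_simps)
  have M': "subst_form M (subst_form (mat2 s (-q) (-r) p) f) = f" for f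
    by (simp add: subst_form_mult pq inv subst_form_one)
  show ?thesis
  proof (rule that[OF 1])
    fix b c d
    have "P v* mat2 s (-q) (-r) p = vector [1, 0]"
      using 1 by (simp add: vector_matrix_mult_def vec_eq_iff forall_2 sum_2 algebra_simps)
    then show "eval_form (subst_form (mat2 s (-q) (-r) p) (Cubic 1 b c d)) P = 1"
      unfolding eval_subst_form by (simp add: eval_form_def)
    show "model (subst_form (mat2 s (-q) (-r) p) (Cubic 1 b c d)) P =
       (let k = (b mod 3 - b) div 3 in (b mod 3, 3 * k^2 + 2 * b * k + c, k^3 + b * k^2 + c * k + d))"
      unfolding model_def M_def[symmetric] Let_def M' n_mat_eq
      by (simp add: subst_form_translation)
  qed
qed

lemma inverse_mat2_det_1:
  fixes p q r s :: "'a::comm_ring_1"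
  assumes "p * s - q * r = 1"
  shows "mat2 p q r s ** mat2 s (-q) (-r) p = mat 1" "mat2 s (-q) (-r) p ** mat2 p q r s = mat 1"
  using assms by (simp_all add: mat2_mult mat_eq_mat2 algebra_simps)

text \<open>The discriminant changes by the positive factor \<open>c^4 * det g^6\<close>, so its
  sign stays that of \<open>v\<close>.\<close>

lemma orbit_forms_at:
  assumes "gauss_range \<nu>" and v: "v \<in> V_real i"
    and "irreducible_over_rat f" "eval_form f P = 1"
    and f: "real_form f = map_cubic_form ((*) c) (subst_form g v)" and "c > 0" and g: "g \<in> siegel_cone"
    and "cm * X \<le> \<bar>real_of_int (disc f)\<bar>" "\<bar>real_of_int (disc f)\<bar> < cp * X"
  shows "f \<in> forms_at (fund_dom \<nu>) i v cm cp P X"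
proof -
  have "det g > 0" using g by (simp add: siegel_cone_def)
  then have "real_form f \<in> V_real i"
    using v \<open>c > 0\<close> unfolding f
    by (auto simp: V_real_def disc_map_times disc_subst_form zero_less_mult_iff mult_less_0_iff split: if_splits)
  then show ?thesis
    using assms siegel_cone_orbit[OF assms(1) g \<open>c > 0\<close>, of v]
    by (simp add: forms_at_def V_int_irr_def)
qed

text \<open>With \<open>X = \<sigma>^6\<close>, the pairs near
  \<open>(A0 \<sigma>^2, B0 \<sigma>^3)\<close> have discriminants of order \<open>X\<close>, and
  there are of order \<open>\<sigma>^5\<close> of them. Replacing \<open>Y\<close> by
  \<open>\<sigma> Y\<close> stretches the second row, so the determinant grows by
  \<open>\<sigma>\<close> while the first row stays; the height condition holds once
  \<open>\<sigma> >= R\<close>. An integral translation then achieves \<open>|u| <= 1/2\<close>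
  without changing the model.\<close>

lemma model_count_axis_ge:
  fixes P :: "int^2"
  assumes \<nu>: "gauss_range \<nu>" and v: "v \<in> V_real i" "disc v \<noteq> 0" and cm: "0 < cm" "cm < cp"
    and P: "primitive P" "P $ 2 = 0"
  obtains \<kappa> where "\<kappa> > 0"
    "\<forall>\<^sub>F X in at_top. \<kappa> * X powr (5/6) \<le> real (model_count (fund_dom \<nu>) i v cm cp P X)"
proof -
  obtain A0 B0 \<eta> R where \<eta>: "\<eta> > 0" and
    nb: "\<And>A B. \<lbrakk>\<bar>A - A0\<bar> < \<eta>; \<bar>B - B0\<bar> < \<eta>\<rbrakk> \<Longrightarrow>
       \<exists>g. det g > 0 \<and> (g$1$1)^2 + (g$1$2)^2 \<le> R * det g \<and> subst_form g v = Cubic 1 0 A B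
         \<and> cm < \<bar>disc (Cubic 1 0 A B)\<bar> \<and> \<bar>disc (Cubic 1 0 A B)\<bar> < cp"
    by (rule depressed_cubic_neighbourhood[OF v(2) cm]) (rule that; assumption)
  obtain p q r s where "p * s - q * r = 1" "P $ 1 = p" "P $ 2 = q" and
    ev: "\<And>b c d. eval_form (subst_form (mat2 s (-q) (-r) p) (Cubic 1 b c d)) P = 1" and
    model: "\<And>b c d. model (subst_form (mat2 s (-q) (-r) p) (Cubic 1 b c d)) P =
       (let k = (b mod 3 - b) div 3 in (b mod 3, 3 * k^2 + 2 * b * k + c, k^3 + b * k^2 + c * k + d))"
    by (rule monic_model[OF P(1)]) (rule that; assumption)
  then have pqs: "q = 0" "p * s = 1"
    using P by auto
  then have ps: "s = p" "p * p = 1"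
    by (auto simp: zmult_eq_1_iff)
  then have pr: "real_of_int p * real_of_int p = 1"
    by (metis of_int_1 of_int_mult)
  show ?thesis
  proof (rule that[of "\<eta>^2 / 4"])
    show "\<eta>^2 / 4 > 0" using \<eta> by simp
    have "\<forall>\<^sub>F X in at_top. max 1 (max R (2 / \<eta>)) \<le> X powr (1/6)"
      by (rule eventually_ge_powr_at_top) simp
    then show "\<forall>\<^sub>F X in at_top. \<eta>^2 / 4 * X powr (5/6) \<le> real (model_count (fund_dom \<nu>) i v cm cp P X)"
      using eventually_gt_at_top[of 0]
    proof eventually_elim
      case (elim X)
      define \<sigma> where "\<sigma> = X powr (1/6)"
      have \<sigma>: "\<sigma> \<ge> 1" "\<sigma> \<ge> R" "\<sigma> \<ge> 2 / \<eta>"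
        using elim by (auto simp: \<sigma>_def)
      have \<sigma>6: "\<sigma>^6 = X" and \<sigma>5: "\<sigma>^5 = X powr (5/6)"
        using elim by (simp_all add: \<sigma>_def powr_power)
      define IA where "IA = {n::int. \<bar>real_of_int n - A0 * \<sigma>^2\<bar> < \<eta> * \<sigma>^2 \<and> even n = False}"
      define IB where "IB = {n::int. \<bar>real_of_int n - B0 * \<sigma>^3\<bar> < \<eta> * \<sigma>^3 \<and> even n = False}"
      have "\<eta> * \<sigma> \<ge> 2"
        using \<sigma>(3) \<eta> by (simp add: field_simps)
      moreover have "\<sigma> \<le> \<sigma>^2" "\<sigma> \<le> \<sigma>^3"
        using \<sigma>(1) by (simp_all add: self_le_power)
      then have "\<eta> * \<sigma> \<le> \<eta> * \<sigma>^2" "\<eta> * \<sigma> \<le> \<eta> * \<sigma>^3"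
        using \<eta> by simp_all
      ultimately have big: "\<eta> * \<sigma>^2 \<ge> 2" "\<eta> * \<sigma>^3 \<ge> 2"
        by linarith+
      have "(\<lambda>(A, B). (0, A, B)) ` (IA \<times> IB) \<subseteq> (\<lambda>f. model f P) ` forms_at (fund_dom \<nu>) i v cm cp P X"
      proof safe
        fix A B assume A: "A \<in> IA" and B: "B \<in> IB"
        define A' where "A' = real_of_int A / \<sigma>^2"
        define B' where "B' = real_of_int B / \<sigma>^3"
        have AB: "real_of_int A = A' * \<sigma>^2" "real_of_int B = B' * \<sigma>^3"
          using \<sigma> by (simp_all add: A'_def B'_def)
        have abs_scale: "\<bar>x - y\<bar> < \<eta>" if "\<bar>x * z - y * z\<bar> < \<eta> * z" "z > 0" for x y z
          using that by (simp add: abs_mult flip: left_diff_distrib)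
        have "\<bar>A' * \<sigma>^2 - A0 * \<sigma>^2\<bar> < \<eta> * \<sigma>^2" "\<bar>B' * \<sigma>^3 - B0 * \<sigma>^3\<bar> < \<eta> * \<sigma>^3"
          using A B unfolding AB[symmetric] by (simp_all add: IA_def IB_def)
        then have "\<bar>A' - A0\<bar> < \<eta>" "\<bar>B' - B0\<bar> < \<eta>"
          using \<sigma>(1) by (auto intro: abs_scale)
        then obtain g where g: "det g > 0" "(g$1$1)^2 + (g$1$2)^2 \<le> R * det g"
          "subst_form g v = Cubic 1 0 A' B'"
          and disc: "cm < \<bar>disc (Cubic 1 0 A' B')\<bar>" "\<bar>disc (Cubic 1 0 A' B')\<bar> < cp"
          using nb by blast
        obtain g1 g2 g3 g4 where gg: "g = mat2 g1 g2 g3 g4" by (rule mat2_exhaust)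
        define N where "N = g1^2 + g2^2"
        define D where "D = g1 * g4 - g2 * g3"
        define E where "E = g1 * g3 + g2 * g4"
        have D: "D > 0" "N \<le> R * D"
          using g by (simp_all add: gg det_mat2 D_def N_def)
        have "g1 \<noteq> 0 \<or> g2 \<noteq> 0" using D by (auto simp: D_def)
        then have "N > 0" by (simp add: N_def sum_power2_gt_zero_iff)
        \<comment> \<open>The rows of \<open>h\<close> below have inner product
          \<open>N * (m - p * r) + \<sigma> * E\<close>; rounding brings it to at most
          \<open>N / 2\<close> in absolute value.\<close>
        define m where "m = p * r + round (- \<sigma> * E / N)"
        define f where "f = subst_form (mat2 s (-q) (-r) p) (Cubic 1 (3 * m) (3 * m^2 + A) (m^3 + A * m + B))"
        have f: "f = subst_form (mat2 p 0 (p * m - r) p) (Cubic 1 0 A B)"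
        proof -
          have "Cubic 1 (3 * m) (3 * m^2 + A) (m^3 + A * m + B) = subst_form (mat2 1 0 m 1) (Cubic 1 0 A B)"
            by (simp add: subst_form_translation)
          then show ?thesis
            unfolding f_def by (simp add: subst_form_mult mat2_mult ps pqs algebra_simps)
        qed
        \<comment> \<open>As \<open>3 * m\<close> is divisible by 3, \<open>model\<close> picks
          \<open>u = 0\<close> and translates back by \<open>- m\<close>, whatever \<open>m\<close>
          is.\<close>
        have "3 * m mod 3 - 3 * m = 3 * (- m)"
          by simp
        then have "(3 * m mod 3 - 3 * m) div 3 = - m"
          by simp
        then have "model f P = (0, A, B)"
          unfolding f_def model Let_def by (simp add: power2_eq_square power3_eq_cube algebra_simps)
        moreover have "f \<in> forms_at (fund_dom \<nu>) i v cm cp P X"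
        proof (rule orbit_forms_at[OF \<nu> v(1)])
          show "eval_form f P = 1"
            unfolding f_def by (rule ev)
          have "p * p - 0 * (p * m - r) = 1" using ps by simp
          then show "irreducible_over_rat f"
            unfolding f using A B
            by (intro irreducible_subst_monic[where M' = "mat2 p (-0) (- (p * m - r)) p"])
               (auto simp only: IA_def IB_def inverse_mat2_det_1 mem_Collect_eq even_zero)
          define h where "h = mat2 (p * g1) (p * g2) ((p * m - r) * g1 + p * \<sigma> * g3) ((p * m - r) * g2 + p * \<sigma> * g4)"
          have "Cubic 1 0 (real_of_int A) (real_of_int B) = subst_form (mat2 1 0 0 \<sigma>) (Cubic 1 0 A' B')"
            by (simp add: subst_form_mat2 AB)
          then have "real_form f = subst_form (mat2 p 0 (p * m - r) p ** (mat2 1 0 0 \<sigma> ** g)) v"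
            unfolding f real_form_subst_mat2 by (simp add: g subst_form_mult[symmetric])
          also have "mat2 p 0 (p * m - r) p ** (mat2 1 0 0 \<sigma> ** g) = h"
            by (simp add: gg mat2_mult h_def algebra_simps)
          finally show "real_form f = map_cubic_form ((*) 1) (subst_form h v)"
            by (cases "subst_form h v") simp
          show "h \<in> siegel_cone"
          proof -
            have deth: "det h = \<sigma> * D"
            proof -
              have "det h = real_of_int p * real_of_int p * (\<sigma> * D)"
                unfolding h_def det_mat2 D_def by (simp add: algebra_simps)
              then show ?thesis by (simp add: pr)
            qed
            have Nh: "(h$1$1)^2 + (h$1$2)^2 = N"
            proof -
              have "(h$1$1)^2 + (h$1$2)^2 = real_of_int p * real_of_int p * N"
                unfolding h_def N_def by (simp add: algebra_simps power2_eq_square)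
              then show ?thesis by (simp add: pr)
            qed
            have "h$1$1 * h$2$1 + h$1$2 * h$2$2 = (real_of_int p * real_of_int p) * (m * N + \<sigma> * E) - p * r * N"
              unfolding h_def N_def E_def by (simp add: algebra_simps power2_eq_square)
            also have "\<dots> = N * (round (- \<sigma> * E / N) - (- \<sigma> * E / N))"
              using \<open>N > 0\<close> by (simp add: pr m_def algebra_simps)
            finally have Eh: "\<bar>h$1$1 * h$2$1 + h$1$2 * h$2$2\<bar> = N * \<bar>round (- \<sigma> * E / N) - (- \<sigma> * E / N)\<bar>"
              using \<open>N > 0\<close> by (simp only: abs_mult abs_of_pos)
            have "N * \<bar>round (- \<sigma> * E / N) - (- \<sigma> * E / N)\<bar> \<le> N * (1/2)"
              using \<open>N > 0\<close> by (intro mult_left_mono of_int_round_abs_le) auto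
            moreover have "R * D \<le> \<sigma> * D"
              using \<sigma> D by (intro mult_right_mono) auto
            then have "N \<le> \<sigma> * D"
              using D by linarith
            ultimately show ?thesis
              using D \<sigma> unfolding siegel_cone_def mem_Collect_eq deth Nh Eh by simp
          qed
          have "disc f = disc (Cubic 1 0 A B)"
            unfolding f disc_subst_form by (simp add: det_mat2 ps)
          then have "real_of_int (disc f) = \<sigma>^6 * disc (Cubic 1 0 A' B')"
            by (simp add: disc_def AB) (simp add: algebra_simps eval_nat_numeral)
          then have "\<bar>real_of_int (disc f)\<bar> = X * \<bar>disc (Cubic 1 0 A' B')\<bar>"
            using elim by (simp add: \<sigma>6 abs_mult)
          then show "cm * X \<le> \<bar>real_of_int (disc f)\<bar>" "\<bar>real_of_int (disc f)\<bar> < cp * X"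
            using disc elim by simp_all
        qed simp
        ultimately show "(0, A, B) \<in> (\<lambda>f. model f P) ` forms_at (fund_dom \<nu>) i v cm cp P X"
          by (metis image_eqI)
      qed
      moreover have "finite (forms_at (fund_dom \<nu>) i v cm cp P X)"
        using finite_forms_at[OF v(2) _ \<nu>] cm elim by auto
      ultimately have "card ((\<lambda>(A, B). (0 :: int, A, B)) ` (IA \<times> IB)) \<le> model_count (fund_dom \<nu>) i v cm cp P X"
        unfolding model_count_def by (intro card_mono finite_imageI)
      also have "card ((\<lambda>(A, B). (0 :: int, A, B)) ` (IA \<times> IB)) = card IA * card IB"
        by (subst card_image) (auto simp: inj_on_def card_cartesian_product)
      finally have "real (card IA) * real (card IB) \<le> real (model_count (fund_dom \<nu>) i v cm cp P X)"
        by (metis of_nat_mult of_nat_le_iff)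
      moreover have "(\<eta> * \<sigma>^2 / 2) * (\<eta> * \<sigma>^3 / 2) \<le> real (card IA) * real (card IB)"
        unfolding IA_def IB_def using \<eta> \<sigma> big by (intro mult_mono card_int_parity_ge) auto
      moreover have "(\<eta> * \<sigma>^2 / 2) * (\<eta> * \<sigma>^3 / 2) = \<eta>^2 / 4 * X powr (5/6)"
        unfolding \<sigma>5[symmetric] by (simp add: eval_nat_numeral)
      ultimately show ?case
        by linarith
    qed
  qed
qed

text \<open>A translate with equal model and \<open>m \<noteq> 0\<close> changes the third coefficient by \<open>m (b + b')\<close>, which is too
  much when both linear coefficients are close to the same large number.\<close>

lemma inj_on_monic_model:
  fixes Y b0 c0 \<eta> :: real
  assumes "Y > 0" "\<eta> \<le> \<bar>b0\<bar> / 2"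
    and box: "\<bar>real_of_int b - b0 * Y\<bar> < \<eta> * Y" "\<bar>real_of_int b' - b0 * Y\<bar> < \<eta> * Y"
      "\<bar>real_of_int c - c0 * Y\<bar> < \<eta> * Y" "\<bar>real_of_int c' - c0 * Y\<bar> < \<eta> * Y"
    and eq: "(let k = (b mod 3 - b) div 3 in (b mod 3, 3 * k^2 + 2 * b * k + c, k^3 + b * k^2 + c * k + d))
      = (let k = (b' mod 3 - b') div 3 in (b' mod 3, 3 * k^2 + 2 * b' * k + c', k^3 + b' * k^2 + c' * k + d'))"
  shows "b = b' \<and> c = c' \<and> d = d'"
proof -
  define k k' where "k = (b mod 3 - b) div 3" and "k' = (b' mod 3 - b') div 3"
  have k: "3 * k = b mod 3 - b" "3 * k' = b' mod 3 - b'"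
    unfolding k_def k'_def by (simp_all add: dvd_mult_div_cancel mod_eq_dvd_iff[symmetric])
  have e: "b mod 3 = b' mod 3" "3 * k^2 + 2 * b * k + c = 3 * k'^2 + 2 * b' * k' + c'"
    "k^3 + b * k^2 + c * k + d = k'^3 + b' * k'^2 + c' * k' + d'"
    using eq unfolding k_def k'_def Let_def prod.inject by blast+
  \<comment> \<open>The integral translation by which the two monic forms with equal model
    differ.\<close>
  define m where "m = k - k'"
  have b': "b' = b + 3 * m"
    using k e(1) by (simp add: m_def)
  have c': "c' - c = m * (b + b')"
  proof -
    have "k = k' + m" by (simp add: m_def)
    then show ?thesis
      using e(2) unfolding b' by (simp add: algebra_simps power2_eq_square)
  qed
  have "m = 0"
  proof (rule ccontr)
    assume "m \<noteq> 0"
    then have "1 \<le> \<bar>real_of_int m\<bar>" by linarith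
    then have "1 * \<bar>real_of_int b + real_of_int b'\<bar> \<le> \<bar>real_of_int m\<bar> * \<bar>real_of_int b + real_of_int b'\<bar>"
      by (intro mult_right_mono) auto
    also have "\<dots> = \<bar>real_of_int (c' - c)\<bar>"
      unfolding c' by (simp add: abs_mult)
    finally have "\<bar>real_of_int b + real_of_int b'\<bar> \<le> \<bar>real_of_int c' - real_of_int c\<bar>"
      by simp
    \<comment> \<open>The estimates clash: \<open>|c' - c| < 2 \<eta> Y\<close>, whereas
      \<open>|b + b'| > 2 |b0| Y - 2 \<eta> Y >= 2 \<eta> Y\<close>.\<close>
    moreover have "\<bar>real_of_int c' - real_of_int c\<bar> < 2 * (\<eta> * Y)"
      using box by linarith
    moreover have "2 * \<bar>b0 * Y\<bar> - 2 * (\<eta> * Y) < \<bar>real_of_int b + real_of_int b'\<bar>"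
      using box by linarith
    moreover have "\<eta> * Y \<le> \<bar>b0\<bar> / 2 * Y"
      using assms by (intro mult_right_mono) auto
    then have "2 * (\<eta> * Y) \<le> \<bar>b0 * Y\<bar>"
      using \<open>Y > 0\<close> by (simp add: abs_mult)
    ultimately show False by linarith
  qed
  then show ?thesis
    using b' c' e(3) by (simp add: m_def)
qed

text \<open>The box of \<open>cone_neighbourhood\<close> is scaled by
  \<open>Y = X powr (1/4)\<close>: a monic form with \<open>b, c, d\<close> near
  \<open>Y b0, Y c0, Y d0\<close> is \<open>Y\<close> times a form in the box whose leading
  coefficient \<open>1 / Y\<close> is small. The inverse of \<open>M\<close> turns monic forms into
  forms with \<open>f(P) = 1\<close>, and distinct triples give distinct models.\<close>

lemma model_count_off_axis_ge:
  fixes P :: "int^2"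
  assumes \<nu>: "gauss_range \<nu>" and v: "v \<in> V_real i" "disc v \<noteq> 0" and cm: "0 < cm" "cm < cp"
    and P: "primitive P" "P $ 2 \<noteq> 0"
  obtains \<kappa> where "\<kappa> > 0"
    "\<forall>\<^sub>F X in at_top. \<kappa> * (X powr (1/4))^3 \<le> real (model_count (fund_dom \<nu>) i v cm cp P X)"
proof -
  obtain p q r s where pqs: "p * s - q * r = 1" "P $ 1 = p" "P $ 2 = q" and
    ev: "\<And>b c d. eval_form (subst_form (mat2 s (-q) (-r) p) (Cubic 1 b c d)) P = 1" and
    model: "\<And>b c d. model (subst_form (mat2 s (-q) (-r) p) (Cubic 1 b c d)) P =
       (let k = (b mod 3 - b) div 3 in (b mod 3, 3 * k^2 + 2 * b * k + c, k^3 + b * k^2 + c * k + d))"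
    by (rule monic_model[OF P(1)]) (rule that; assumption)
  define M where "M = mat2 (real_of_int p) q r s"
  define M' where "M' = mat2 (real_of_int s) (-q) (-r) p"
  have pqs': "real_of_int p * real_of_int s - real_of_int q * real_of_int r = 1"
    using pqs(1) by (metis of_int_1 of_int_diff of_int_mult)
  have M: "det M = 1" "M' ** M = mat 1" "M $ 1 $ 2 \<noteq> 0"
    using pqs' inverse_mat2_det_1(2)[OF pqs'] P pqs by (simp_all add: M_def M'_def det_mat2)
  obtain b0 c0 d0 \<eta>0 where \<eta>0: "\<eta>0 > 0" "b0 \<noteq> 0" and
    nb: "\<And>a b c d. \<lbrakk>\<bar>a\<bar> < \<eta>0; \<bar>b - b0\<bar> < \<eta>0; \<bar>c - c0\<bar> < \<eta>0; \<bar>d - d0\<bar> < \<eta>0\<rbrakk> \<Longrightarrow>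
       \<exists>g\<in>siegel_cone. subst_form M' (Cubic a b c d) = subst_form g v
         \<and> cm < \<bar>disc (Cubic a b c d)\<bar> \<and> \<bar>disc (Cubic a b c d)\<bar> < cp"
    by (rule cone_neighbourhood[OF v(2) cm M]) (rule that; assumption)
  \<comment> \<open>The bound \<open>|b0| / 2\<close> is the one that
    \<open>inj_on_monic_model\<close> asks for.\<close>
  define \<eta> where "\<eta> = min \<eta>0 (\<bar>b0\<bar> / 2)"
  have \<eta>: "\<eta> > 0" "\<eta> \<le> \<eta>0" "\<eta> \<le> \<bar>b0\<bar> / 2"
    using \<eta>0 by (auto simp: \<eta>_def)
  show ?thesis
  proof (rule that[of "\<eta>^3 / 8"])
    show "\<eta>^3 / 8 > 0" using \<eta> by simp
    have "\<forall>\<^sub>F X in at_top. 2 / \<eta> \<le> X powr (1/4)"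
      by (rule eventually_ge_powr_at_top) simp
    then show "\<forall>\<^sub>F X in at_top. \<eta>^3 / 8 * (X powr (1/4))^3 \<le> real (model_count (fund_dom \<nu>) i v cm cp P X)"
      using eventually_gt_at_top[of 0]
    proof eventually_elim
      case (elim X)
      define Y where "Y = X powr (1/4)"
      have "Y > 0" using elim by (simp add: Y_def)
      then have "2 \<le> \<eta> * Y"
        using elim \<eta> by (simp add: Y_def field_simps)
      moreover have "\<eta> * Y \<le> \<eta>0 * Y"
        using \<open>Y > 0\<close> \<eta> by (intro mult_right_mono) auto
      ultimately have Y: "2 \<le> \<eta> * Y" and "1 < \<eta>0 * Y"
        by linarith+
      then have Y': "1 / Y < \<eta>0"
        using \<open>Y > 0\<close> by (simp add: field_simps)
      have Y4: "Y^4 = X"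
        using elim by (simp add: Y_def powr_power)
      define I where "I x e = {n::int. \<bar>real_of_int n - x * Y\<bar> < \<eta> * Y \<and> even n = e}" for x e
      have I: "finite (I x e)" "\<eta> * Y / 2 \<le> real (card (I x e))" for x e
        unfolding I_def by (rule card_int_parity_ge[OF Y])+
      define F where "F = (\<lambda>(b, c, d). subst_form (mat2 s (-q) (-r) p) (Cubic 1 b c d))"
      define S where "S = I b0 True \<times> I c0 False \<times> I d0 False"
      have "F x \<in> forms_at (fund_dom \<nu>) i v cm cp P X" if "x \<in> S" for x
      proof -
        obtain b c d where x: "x = (b, c, d)" by (cases x)
        have b: "b \<in> I b0 True" and c: "c \<in> I c0 False" and d: "d \<in> I d0 False"
          using that by (auto simp: x S_def)
        have F: "F x = subst_form (mat2 s (-q) (-r) p) (Cubic 1 b c d)"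
          by (simp add: x F_def)
        have scale: "\<bar>real_of_int n / Y - z\<bar> < \<eta>0" if "n \<in> I z e" for n z e
        proof -
          have "real_of_int n - z * Y = (real_of_int n / Y - z) * Y"
            using \<open>Y > 0\<close> by (simp add: field_simps)
          then have "\<bar>real_of_int n / Y - z\<bar> * Y < \<eta> * Y"
            using that \<open>Y > 0\<close> by (simp add: I_def abs_mult)
          then show ?thesis
            using \<open>Y > 0\<close> \<eta> by simp
        qed
        have "\<bar>1 / Y\<bar> < \<eta>0"
          using Y' \<open>Y > 0\<close> by simp
        from nb[OF this scale[OF b] scale[OF c] scale[OF d]]
        obtain g where g: "g \<in> siegel_cone" "subst_form M' (Cubic (1 / Y) (b / Y) (c / Y) (d / Y)) = subst_form g v"
          and disc: "cm < \<bar>disc (Cubic (1 / Y) (b / Y) (c / Y) (d / Y))\<bar>"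
            "\<bar>disc (Cubic (1 / Y) (b / Y) (c / Y) (d / Y))\<bar> < cp"
          by blast
        have cubic: "Cubic 1 (real_of_int b) c d = map_cubic_form ((*) Y) (Cubic (1 / Y) (b / Y) (c / Y) (d / Y))"
          using \<open>Y > 0\<close> by simp
        show ?thesis
        proof (rule orbit_forms_at[OF \<nu> v(1) _ _ _ \<open>Y > 0\<close> g(1)])
          show "irreducible_over_rat (F x)"
            unfolding F using b c d inverse_mat2_det_1[OF pqs(1)]
            by (intro irreducible_subst_monic[where M' = "mat2 p q r s"]) (simp_all add: I_def)
          show "eval_form (F x) P = 1"
            unfolding F by (rule ev)
          have "real_form (F x) = subst_form M' (Cubic 1 b c d)"
            unfolding F real_form_subst_mat2 M'_def by simp
          also have "\<dots> = map_cubic_form ((*) Y) (subst_form M' (Cubic (1 / Y) (b / Y) (c / Y) (d / Y)))"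
            unfolding cubic M'_def by (simp add: subst_form_mat2 algebra_simps add_divide_distrib)
          finally show "real_form (F x) = map_cubic_form ((*) Y) (subst_form g v)"
            by (simp add: g)
          have "det (mat2 s (-q) (-r) p) = 1"
            using pqs(1) by (simp add: det_mat2 mult.commute)
          then have "disc (F x) = disc (Cubic 1 b c d)"
            unfolding F disc_subst_form by simp
          then have "real_of_int (disc (F x)) = disc (Cubic 1 (real_of_int b) c d)"
            by (simp add: disc_def)
          \<comment> \<open>The discriminant has degree 4 in the coefficients, and
            \<open>Y^4 = X\<close>.\<close>
          also have "\<dots> = X * disc (Cubic (1 / Y) (b / Y) (c / Y) (d / Y))"
            unfolding cubic disc_map_times Y4 ..
          finally have "\<bar>real_of_int (disc (F x))\<bar> = X * \<bar>disc (Cubic (1 / Y) (b / Y) (c / Y) (d / Y))\<bar>"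
            using elim by (simp add: abs_mult)
          then show "cm * X \<le> \<bar>real_of_int (disc (F x))\<bar>" "\<bar>real_of_int (disc (F x))\<bar> < cp * X"
            using disc elim by simp_all
        qed
      qed
      then have sub: "(\<lambda>x. model (F x) P) ` S \<subseteq> (\<lambda>f. model f P) ` forms_at (fund_dom \<nu>) i v cm cp P X"
        by blast
      have inj: "inj_on (\<lambda>x. model (F x) P) S"
      proof (rule inj_onI)
        fix x x' assume xs: "x \<in> S" "x' \<in> S" "model (F x) P = model (F x') P"
        obtain b c d where x: "x = (b, c, d)" by (cases x)
        obtain b' c' d' where x': "x' = (b', c', d')" by (cases x')
        have "b = b' \<and> c = c' \<and> d = d'"
          by (rule inj_on_monic_model[OF \<open>Y > 0\<close> \<eta>(3), of b b' c c0 c'])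
             (use xs in \<open>auto simp: S_def I_def x x' F_def model\<close>)
        then show "x = x'" by (simp add: x x')
      qed
      have "finite (forms_at (fund_dom \<nu>) i v cm cp P X)"
        using finite_forms_at[OF v(2) _ \<nu>] cm elim by auto
      then have "card S \<le> model_count (fund_dom \<nu>) i v cm cp P X"
        unfolding model_count_def by (intro card_inj_on_le[OF inj sub] finite_imageI)
      moreover have "card S = card (I b0 True) * (card (I c0 False) * card (I d0 False))"
        by (simp add: S_def card_cartesian_product)
      ultimately have "real (card (I b0 True)) * (real (card (I c0 False)) * real (card (I d0 False)))
          \<le> real (model_count (fund_dom \<nu>) i v cm cp P X)"
        by (metis of_nat_mult of_nat_le_iff)
      moreover have "\<eta> * Y / 2 * (\<eta> * Y / 2 * (\<eta> * Y / 2))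
          \<le> real (card (I b0 True)) * (real (card (I c0 False)) * real (card (I d0 False)))"
        using \<eta> \<open>Y > 0\<close> by (intro mult_mono I) auto
      moreover have "\<eta> * Y / 2 * (\<eta> * Y / 2 * (\<eta> * Y / 2)) = \<eta>^3 / 8 * (X powr (1/4))^3"
        unfolding Y_def[symmetric] by (simp add: power3_eq_cube)
      ultimately show ?case
        by linarith
    qed
  qed
qed

section \<open>The limits\<close>

lemma model_count_cusp_le:
  assumes "finite (forms_at (fund_dom \<nu>) i v cm cp P X)"
  shows "model_count (fund_dom_cusp \<nu> T) i v cm cp P X \<le> model_count (fund_dom \<nu>) i v cm cp P X"
  unfolding model_count_def
  by (intro card_mono finite_imageI image_mono forms_at_cusp_subset assms)

text \<open>For fixed \<open>T\<close> the forms outside the cusp piece number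
  \<open>O(X powr (3/4))\<close>, against at least a multiple of \<open>X powr (5/6)\<close> models
  in total. The ratio misses 1 by \<open>O(X powr (-1/12))\<close>.\<close>

lemma cusp_ratio_axis_tendsto:
  fixes P :: "int^2"
  assumes \<nu>: "gauss_range \<nu>" and v: "v \<in> V_real i" "disc v \<noteq> 0" and cm: "0 < cm" "cm < cp"
    and P: "primitive P" "P $ 2 = 0" and T: "T \<ge> 1"
  shows "((\<lambda>X. cusp_ratio \<nu> i v cm cp P T X) \<longlongrightarrow> 1) at_top"
proof -
  have "cp > 0" using cm by simp
  obtain K where K: "K > 0"
    "\<And>\<nu> i cm P X f. \<lbrakk>gauss_range \<nu>; X > 0; f \<in> forms_at (fund_dom \<nu>) i v cm cp P X\<rbrakk> \<Longrightarrow>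
       \<exists>t\<ge>1/2. coeff_bounds (K * X powr (1/4)) t f
         \<and> (\<forall>T<t. f \<in> forms_at (fund_dom_cusp \<nu> T) i v cm cp P X)"
    by (rule forms_at_coeff_bounds[OF v(2) \<open>cp > 0\<close>]) (rule that; assumption)
  obtain \<kappa> where \<kappa>: "\<kappa> > 0"
    and lower: "\<forall>\<^sub>F X in at_top. \<kappa> * X powr (5/6) \<le> real (model_count (fund_dom \<nu>) i v cm cp P X)"
    using model_count_axis_ge[OF \<nu> v cm P] by blast
  have "\<bar>P $ 1\<bar> = 1"
    using P by (simp add: primitive_def)
  define c where "c = (4 * K * T^3 + 1)^3 / \<kappa>"
  have ev: "\<forall>\<^sub>F X in at_top. 1 - c * X powr (- 1/12) \<le> cusp_ratio \<nu> i v cm cp P T X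
      \<and> cusp_ratio \<nu> i v cm cp P T X \<le> 1"
    using lower eventually_ge_at_top[of 1]
  proof eventually_elim
    case (elim X)
    then have "X > 0" by simp
    define Y where "Y = X powr (1/4)"
    have Y: "Y \<ge> 1" using elim by (simp add: Y_def ge_one_powr_ge_zero)
    define C where "C = real (model_count (fund_dom \<nu>) i v cm cp P X)"
    define C' where "C' = real (model_count (fund_dom_cusp \<nu> T) i v cm cp P X)"
    have fin: "finite (forms_at (fund_dom \<nu>) i v cm cp P X)"
      using finite_forms_at[OF v(2) \<open>cp > 0\<close> \<nu> \<open>X > 0\<close>] .
    have C: "C \<ge> \<kappa> * X powr (5/6)" "C > 0"
    proof -
      show "C \<ge> \<kappa> * X powr (5/6)"
        using elim unfolding C_def by simp
      moreover have "0 < \<kappa> * X powr (5/6)"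
        using \<kappa> \<open>X > 0\<close> by simp
      ultimately show "C > 0" by linarith
    qed
    have "C' \<le> C"
      unfolding C_def C'_def of_nat_le_iff by (rule model_count_cusp_le[OF fin])
    define S where "S = {f. ca f = P $ 1 \<and> (\<exists>t. 1/2 \<le> t \<and> t \<le> T \<and> coeff_bounds (K * Y) t f)}"
    have "forms_at (fund_dom \<nu>) i v cm cp P X \<subseteq> forms_at (fund_dom_cusp \<nu> T) i v cm cp P X \<union> S"
    proof
      fix f assume f: "f \<in> forms_at (fund_dom \<nu>) i v cm cp P X"
      then obtain t where t: "t \<ge> 1/2" "coeff_bounds (K * Y) t f"
        "\<And>T. T < t \<Longrightarrow> f \<in> forms_at (fund_dom_cusp \<nu> T) i v cm cp P X"
        unfolding Y_def using K(2)[OF \<nu> \<open>X > 0\<close>] by blast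
      \<comment> \<open>With \<open>P $ 2 = 0\<close> the value at \<open>P\<close> involves only
        the leading coefficient.\<close>
      have "ca f * (P $ 1)^3 = 1"
        using f P by (simp add: forms_at_def eval_form_def)
      then have "ca f = P $ 1"
        using \<open>\<bar>P $ 1\<bar> = 1\<close> by (auto simp: abs_if split: if_splits)
      then show "f \<in> forms_at (fund_dom_cusp \<nu> T) i v cm cp P X \<union> S"
        using t by (cases "T < t") (auto simp: S_def)
    qed
    \<comment> \<open>A model may come from both pieces, so the counts are only compared by
      subadditivity.\<close>
    then have sub: "(\<lambda>f. model f P) ` forms_at (fund_dom \<nu>) i v cm cp P X
        \<subseteq> (\<lambda>f. model f P) ` forms_at (fund_dom_cusp \<nu> T) i v cm cp P X \<union> (\<lambda>f. model f P) ` S"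
      by blast
    have S: "finite S" "real (card S) \<le> (4 * (K * Y) * T^3 + 1)^3"
      using card_main_body_le[of "K * Y" T] K(1) Y T unfolding S_def by simp_all
    have "card ((\<lambda>f. model f P) ` forms_at (fund_dom \<nu>) i v cm cp P X)
        \<le> card ((\<lambda>f. model f P) ` forms_at (fund_dom_cusp \<nu> T) i v cm cp P X \<union> (\<lambda>f. model f P) ` S)"
      using S(1) finite_subset[OF forms_at_cusp_subset fin]
      by (intro card_mono[OF _ sub] finite_UnI finite_imageI)
    also have "\<dots> \<le> model_count (fund_dom_cusp \<nu> T) i v cm cp P X + card S"
      unfolding model_count_def by (intro order_trans[OF card_Un_le] add_mono card_image_le S) auto
    finally have "C \<le> C' + real (card S)"
      unfolding C_def C'_def model_count_def by (metis of_nat_add of_nat_le_iff)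
    also have "real (card S) \<le> ((4 * K * T^3 + 1) * Y)^3"
    proof -
      have "4 * (K * Y) * T^3 + 1 \<le> (4 * K * T^3 + 1) * Y"
        using Y by (simp add: algebra_simps)
      moreover have "0 \<le> 4 * (K * Y) * T^3 + 1"
        using K(1) Y T by simp
      ultimately have "(4 * (K * Y) * T^3 + 1)^3 \<le> ((4 * K * T^3 + 1) * Y)^3"
        by (rule power_mono)
      with S(2) show ?thesis
        by (rule order_trans)
    qed
    also have "\<dots> = c * \<kappa> * X powr (3/4)"
    proof -
      have "Y^3 = X powr (3/4)"
        using \<open>X > 0\<close> by (simp add: Y_def powr_power)
      then show ?thesis
        unfolding power_mult_distrib c_def using \<kappa> by simp
    qed
    also have "\<dots> = c * X powr (- 1/12) * (\<kappa> * X powr (5/6))"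
      using \<open>X > 0\<close> by (simp flip: powr_add)
    also have "\<dots> \<le> c * X powr (- 1/12) * C"
      using C K(1) T \<kappa> by (intro mult_left_mono) (auto simp: c_def)
    finally have "1 - c * X powr (- 1/12) \<le> C' / C"
      using C(2) by (simp add: field_simps)
    then show ?case
      using \<open>C' \<le> C\<close> C(2) by (simp add: cusp_ratio_def C_def C'_def)
  qed
  have "((\<lambda>X::real. X powr (- 1/12)) \<longlongrightarrow> 0) at_top"
    by (rule tendsto_neg_powr) (auto intro: filterlim_ident)
  then have "((\<lambda>X. 1 - c * X powr (- 1/12)) \<longlongrightarrow> 1 - c * 0) at_top"
    by (intro tendsto_intros)
  then have "((\<lambda>X. 1 - c * X powr (- 1/12)) \<longlongrightarrow> 1) at_top"
    by simp
  then show ?thesis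
    by (rule tendsto_sandwich[rotated 2, OF _ tendsto_const]) (use ev in \<open>auto elim: eventually_mono\<close>)
qed

text \<open>The cusp contributes at most \<open>36 (K Y)^3 / T\<close> forms and the whole domain at
  least \<open>\<kappa> Y^3\<close> models. The powers of \<open>Y\<close> cancel, and
  \<open>c\<close> is independent of \<open>T\<close>.\<close>

lemma cusp_ratio_off_axis_le:
  fixes P :: "int^2"
  assumes \<nu>: "gauss_range \<nu>" and v: "v \<in> V_real i" "disc v \<noteq> 0" and cm: "0 < cm" "cm < cp"
    and P: "primitive P" "P $ 2 \<noteq> 0"
  obtains c where "\<And>T. T \<ge> 1 \<Longrightarrow> \<forall>\<^sub>F X in at_top. cusp_ratio \<nu> i v cm cp P T X \<le> c / T"
proof -
  have "cp > 0" using cm by simp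
  obtain K where K: "K > 0"
    "\<And>\<nu> i cm P X T f. \<lbrakk>gauss_range \<nu>; X > 0; f \<in> forms_at (fund_dom_cusp \<nu> T) i v cm cp P X\<rbrakk> \<Longrightarrow>
       \<exists>t\<ge>1/2. t > T \<and> coeff_bounds (K * X powr (1/4)) t f"
    by (rule forms_at_coeff_bounds[OF v(2) \<open>cp > 0\<close>]) (rule that; assumption)
  obtain \<kappa> where \<kappa>: "\<kappa> > 0"
    and lower: "\<forall>\<^sub>F X in at_top. \<kappa> * (X powr (1/4))^3 \<le> real (model_count (fund_dom \<nu>) i v cm cp P X)"
    using model_count_off_axis_ge[OF \<nu> v cm P] by blast
  show ?thesis
  proof (rule that[of "36 * K^3 / \<kappa>"])
    fix T :: real assume T: "T \<ge> 1"
    show "\<forall>\<^sub>F X in at_top. cusp_ratio \<nu> i v cm cp P T X \<le> 36 * K^3 / \<kappa> / T"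
      using lower eventually_gt_at_top[of 0]
    proof eventually_elim
      case (elim X)
      define Y where "Y = X powr (1/4)"
      have Y: "Y > 0" using elim by (simp add: Y_def)
      define S where "S = {f. eval_form f P = 1 \<and> ca f \<noteq> 0 \<and> (\<exists>t>T. coeff_bounds (K * Y) t f)}"
      have "S \<subseteq> {f. ca f \<noteq> 0 \<and> (\<exists>t\<ge>1/2. coeff_bounds (K * Y) t f)}"
        unfolding S_def using T by force
      then have finS: "finite S"
        using finite_coeff_bounds[of "K * Y"] K(1) Y by (meson finite_subset less_imp_le mult_pos_pos)
      have sub: "forms_at (fund_dom_cusp \<nu> T) i v cm cp P X \<subseteq> S"
      proof
        fix f assume f: "f \<in> forms_at (fund_dom_cusp \<nu> T) i v cm cp P X"
        then have "eval_form f P = 1" by (simp add: forms_at_def)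
        then show "f \<in> S"
          using K(2)[OF \<nu> elim(2) f] forms_at_lead_coeff_nonzero[OF f] unfolding S_def Y_def by blast
      qed
      have "model_count (fund_dom_cusp \<nu> T) i v cm cp P X \<le> card S"
        unfolding model_count_def
        using sub finS by (meson card_image_le card_mono finite_subset order_trans)
      then have upper: "real (model_count (fund_dom_cusp \<nu> T) i v cm cp P X) \<le> 36 * (K * Y)^3 / T"
        using card_cusp_le[OF P(2) T, of "K * Y"] K(1) Y unfolding S_def
        by (meson mult_pos_pos of_nat_le_iff order_trans)
      have "cusp_ratio \<nu> i v cm cp P T X \<le> (36 * (K * Y)^3 / T) / (\<kappa> * Y^3)"
        unfolding cusp_ratio_def using upper elim(1) \<kappa> Y T K(1)
        by (intro frac_le) (auto simp: Y_def)
      also have "\<dots> = 36 * K^3 / \<kappa> / T"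
        using Y by (simp add: power_mult_distrib)
      finally show ?case .
    qed
  qed
qed

theorem theorem40:
  fixes i :: nat and v :: "real cubic_form" and \<nu> :: "real \<Rightarrow> real set" and cm cp :: real
  assumes "i \<in> {0, 1}"
    and "v \<in> V_real i" and "shape v = \<i>"
    and "gauss_range \<nu>"
    and "0 < cm" and "cm < cp"
  shows "(\<forall>P \<in> {vector [1, 0], vector [-1, 0]}.
            ((\<lambda>T. Liminf at_top (\<lambda>X. ereal (cusp_ratio \<nu> i v cm cp P T X))) \<longlongrightarrow> 1) at_top) \<and>
         (\<forall>P. primitive P \<and> P \<notin> {vector [1, 0], vector [-1, 0]} \<longrightarrow>
            ((\<lambda>T. Limsup at_top (\<lambda>X. ereal (cusp_ratio \<nu> i v cm cp P T X))) \<longlongrightarrow> 0) at_top)"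
proof (intro conjI ballI allI impI)
  have v: "disc v \<noteq> 0"
    using assms(2) by (auto simp: V_real_def split: if_splits)
  note asm = assms(4,2) v assms(5,6)
  show "((\<lambda>T. Liminf at_top (\<lambda>X. ereal (cusp_ratio \<nu> i v cm cp P T X))) \<longlongrightarrow> 1) at_top"
    if "P \<in> {vector [1, 0], vector [-1, 0]}" for P
  proof -
    have P: "primitive P" "P $ 2 = 0"
      using that by (auto simp: primitive_def)
    \<comment> \<open>The inner limit equals 1 for every \<open>T >= 1\<close>, so the outer limit
      is that of an eventually constant function.\<close>
    have "\<forall>\<^sub>F T in at_top. Liminf at_top (\<lambda>X. ereal (cusp_ratio \<nu> i v cm cp P T X)) = 1"
      using eventually_ge_at_top[of 1]
    proof eventually_elim
      case (elim T)
      have "((\<lambda>X. ereal (cusp_ratio \<nu> i v cm cp P T X)) \<longlongrightarrow> ereal 1) at_top"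
        by (intro tendsto_ereal cusp_ratio_axis_tendsto asm P elim)
      then show ?case
        by (simp add: lim_imp_Liminf one_ereal_def)
    qed
    then show ?thesis
      by (rule tendsto_eventually)
  qed
  show "((\<lambda>T. Limsup at_top (\<lambda>X. ereal (cusp_ratio \<nu> i v cm cp P T X))) \<longlongrightarrow> 0) at_top"
    if "primitive P \<and> P \<notin> {vector [1, 0], vector [-1, 0]}" for P
  proof -
    have P: "primitive P" using that by simp
    have "P $ 2 \<noteq> 0"
    proof
      assume "P $ 2 = 0"
      moreover from this have "\<bar>P $ 1\<bar> = 1"
        using P by (simp add: primitive_def)
      then have "P $ 1 = 1 \<or> P $ 1 = -1" by linarith
      ultimately have "P = vector [1, 0] \<or> P = vector [-1, 0]"
        by (auto simp: vec_eq_iff forall_2)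
      then show False using that by simp
    qed
    from cusp_ratio_off_axis_le[OF asm P this] obtain c where
      c: "\<And>T. T \<ge> 1 \<Longrightarrow> \<forall>\<^sub>F X in at_top. cusp_ratio \<nu> i v cm cp P T X \<le> c / T"
      by blast
    show ?thesis
    proof (rule tendsto_sandwich[where f = "\<lambda>_. 0" and h = "\<lambda>T. ereal (c / T)"])
      \<comment> \<open>Nonnegativity also covers a vanishing denominator, where the quotient is 0
        by convention.\<close>
      show "\<forall>\<^sub>F T in at_top. 0 \<le> Limsup at_top (\<lambda>X. ereal (cusp_ratio \<nu> i v cm cp P T X))"
        by (intro always_eventually allI le_Limsup) (auto simp: cusp_ratio_def)
      show "\<forall>\<^sub>F T in at_top. Limsup at_top (\<lambda>X. ereal (cusp_ratio \<nu> i v cm cp P T X)) \<le> ereal (c / T)"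
        using eventually_ge_at_top[of 1]
        by eventually_elim (auto intro!: Limsup_bounded dest!: c)
      have "((\<lambda>T. c / T) \<longlongrightarrow> 0) at_top"
        by (intro tendsto_divide_0[OF tendsto_const] filterlim_at_top_imp_at_infinity filterlim_ident)
      then show "((\<lambda>T. ereal (c / T)) \<longlongrightarrow> 0) at_top"
        unfolding zero_ereal_def by (intro tendsto_ereal)
    qed simp
  qed
qed

end
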